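(* Let $r\ge 2$, $t\ge 1$ be fixed integers and let $f_i= g_{i1}*\cdots *g_{it}$ $(1\le i\le r)$, where $g_{ij}:\mathbb{N}\to\mathbb{C}$ are nonzero completely multiplicative functions $(1\le i\le r,\ 1\le j\le t)$. Then (formally or in the case of absolute convergence) $$\sum_{\substack{n_1,\ldots,n_r=1\\ \gcd(n_i,n_j)=1 \, (i\ne j)}}^{\infty} \frac{f_1(n_1)\cdots f_r(n_r)}{n_1^{s_1}\cdots n_r^{s_r}} = D(f_1,s_1)\cdots D(f_r,s_r)\, \overline{\Delta}(f_1,\ldots,f_r,s_1,\ldots,s_r),$$ where $$\overline{\Delta}(f_1,\ldots,f_r,s_1,\ldots,s_r)= \prod_p \biggl(1- \sum_{i=2}^r (i-1) \sum_{1\le \ell_1<\cdots <\ell_i\le r}\ \sum_{a_{\ell_1},\ldots,a_{\ell_i}=1}^t \frac1{p^{a_{\ell_1}s_{\ell_1}+\cdots +a_{\ell_i}s_{\ell_i}}} \prod_{m=1}^i (-1)^{a_{\ell_m}} G_{\ell_m a_{\ell_m}}(p)\biggr),$$ the product being over all primes $p$, and $$G_{ij}(p):= \sum_{1\le \ell_1<\cdots <\ell_j\le t} g_{i\ell_1}(p)\cdots g_{i\ell_j}(p)\qquad (1\le i\le r,\ 1\le j\le t,\ p \text{ prime}).$$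
   Context: $\mathbb{N}=\{1,2,\ldots\}$. For $f,g:\mathbb{N}\to\mathbb{C}$, $(f*g)(n)=\sum_{d\mid n} f(d)g(n/d)$ is the Dirichlet convolution. A nonzero function $f:\mathbb{N}\to\mathbb{C}$ is completely multiplicative if $f(mn)=f(m)f(n)$ for all $m,n\in\mathbb{N}$. $D(f,s)=\sum_{n=1}^\infty f(n)n^{-s}$ is the Dirichlet series of $f$. The left-hand sum is over $r$-tuples of pairwise relatively prime positive integers. "Formally or in the case of absolute convergence" means: the identity holds as an identity of formal Dirichlet series in $s_1,\ldots,s_r$ (with formal Euler products), and it holds as an identity of complex numbers at all $(s_1,\ldots,s_r)\in\mathbb{C}^r$ for which the Dirichlet series and Euler products occurring in it converge absolutely. *)

theory Defs
  imports "HOL-Analysis.Analysis" "HOL-Computational_Algebra.Primes"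
begin

section \<open>Arithmetic functions\<close>

text \<open>
  Arithmetic functions are of type \<^typ>\<open>nat \<Rightarrow> complex\<close>; only their values at positive
  arguments are meaningful, and the value at 0 is never constrained or used.
\<close>

definition completely_mult :: "(nat \<Rightarrow> complex) \<Rightarrow> bool" where
  "completely_mult g \<longleftrightarrow>
     (\<exists>n\<ge>1. g n \<noteq> 0) \<and> (\<forall>m\<ge>1. \<forall>n\<ge>1. g (m * n) = g m * g n)"

definition dconv :: "(nat \<Rightarrow> complex) \<Rightarrow> (nat \<Rightarrow> complex) \<Rightarrow> nat \<Rightarrow> complex" where
  "dconv f g n = (\<Sum>d | d dvd n. f d * g (n div d))"

text \<open>\<open>dconv_upto h t\<close> is \<open>h 1 * \<dots> * h t\<close>; the empty convolution is the unit of \<open>dconv\<close>.\<close>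

primrec dconv_upto :: "(nat \<Rightarrow> nat \<Rightarrow> complex) \<Rightarrow> nat \<Rightarrow> nat \<Rightarrow> complex" where
  "dconv_upto h 0 = (\<lambda>n. if n = 1 then 1 else 0)"
| "dconv_upto h (Suc t) = dconv (dconv_upto h t) (h (Suc t))"

definition dirichlet_series :: "(nat \<Rightarrow> complex) \<Rightarrow> complex \<Rightarrow> complex" where
  "dirichlet_series f s = (\<Sum>n. f (Suc n) / of_nat (Suc n) powr s)"

definition dirichlet_abs_conv :: "(nat \<Rightarrow> complex) \<Rightarrow> complex \<Rightarrow> bool" where
  "dirichlet_abs_conv f s \<longleftrightarrow> summable (\<lambda>n. norm (f (Suc n) / of_nat (Suc n) powr s))"

text \<open>
  \<open>G g t i j p\<close> is the \<open>j\<close>-th elementary symmetric polynomial of \<open>g i 1 p, \<dots>, g i t p\<close>.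
  Here and below, increasing index sequences \<open>\<ell>\<^sub>1 < \<dots> < \<ell>\<^sub>j\<close> are identified with their sets of
  entries, i.e. with the sets \<open>L\<close> of cardinality \<open>j\<close>.
\<close>

definition G :: "(nat \<Rightarrow> nat \<Rightarrow> nat \<Rightarrow> complex) \<Rightarrow> nat \<Rightarrow> nat \<Rightarrow> nat \<Rightarrow> nat \<Rightarrow> complex" where
  "G g t i j p = (\<Sum>L | L \<subseteq> {1..t} \<and> card L = j. \<Prod>l\<in>L. g i l p)"

section \<open>Tuples and the analytic objects\<close>

definition tuples :: "nat \<Rightarrow> (nat \<Rightarrow> nat) set" where
  "tuples r = {1..r} \<rightarrow>\<^sub>E {1..}"

definition coprime_tuples :: "nat \<Rightarrow> (nat \<Rightarrow> nat) set" where
  "coprime_tuples r =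
     {n \<in> tuples r. \<forall>i\<in>{1..r}. \<forall>j\<in>{1..r}. i \<noteq> j \<longrightarrow> coprime (n i) (n j)}"

definition multi_term ::
    "nat \<Rightarrow> (nat \<Rightarrow> nat \<Rightarrow> complex) \<Rightarrow> (nat \<Rightarrow> complex) \<Rightarrow> (nat \<Rightarrow> nat) \<Rightarrow> complex" where
  "multi_term r f s n = (\<Prod>i\<in>{1..r}. f i (n i)) / (\<Prod>i\<in>{1..r}. of_nat (n i) powr s i)"

definition euler_factor ::
    "nat \<Rightarrow> nat \<Rightarrow> (nat \<Rightarrow> nat \<Rightarrow> nat \<Rightarrow> complex) \<Rightarrow> (nat \<Rightarrow> complex) \<Rightarrow> nat \<Rightarrow> complex" where
  "euler_factor r t g s p =
     1 - (\<Sum>i=2..r. (of_nat i - 1) *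
           (\<Sum>L | L \<subseteq> {1..r} \<and> card L = i. \<Sum>a\<in>L \<rightarrow>\<^sub>E {1..t}.
              1 / of_nat p powr (\<Sum>l\<in>L. of_nat (a l) * s l) *
              (\<Prod>l\<in>L. (- 1) ^ a l * G g t l (a l) p)))"

text \<open>The Euler product runs over primes; the other positions are filled with the factor 1.\<close>

definition euler_factor_seq ::
    "nat \<Rightarrow> nat \<Rightarrow> (nat \<Rightarrow> nat \<Rightarrow> nat \<Rightarrow> complex) \<Rightarrow> (nat \<Rightarrow> complex) \<Rightarrow> nat \<Rightarrow> complex" where
  "euler_factor_seq r t g s p = (if prime p then euler_factor r t g s p else 1)"

definition Delta_bar ::
    "nat \<Rightarrow> nat \<Rightarrow> (nat \<Rightarrow> nat \<Rightarrow> nat \<Rightarrow> complex) \<Rightarrow> (nat \<Rightarrow> complex) \<Rightarrow> complex" where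
  "Delta_bar r t g s = prodinf (euler_factor_seq r t g s)"

section \<open>Formal Dirichlet series in several variables\<close>

text \<open>
  The formal series \<open>\<Sum> F(n\<^sub>1,\<dots>,n\<^sub>r) n\<^sub>1\<^bsup>-s\<^sub>1\<^esup> \<cdots> n\<^sub>r\<^bsup>-s\<^sub>r\<^esup>\<close> is represented by its coefficient function
  \<open>F\<close>, which is 0 outside \<^term>\<open>tuples r\<close>.
\<close>

type_synonym fds = "(nat \<Rightarrow> nat) \<Rightarrow> complex"

definition fds_monom :: "nat \<Rightarrow> (nat \<Rightarrow> nat) \<Rightarrow> fds" where
  "fds_monom r m n = (if n = restrict m {1..r} then 1 else 0)"

definition fds_one :: "nat \<Rightarrow> fds" where
  "fds_one r = fds_monom r (\<lambda>i. 1)"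

definition fds_mult :: "nat \<Rightarrow> fds \<Rightarrow> fds \<Rightarrow> fds" where
  "fds_mult r F H n =
     (if n \<in> tuples r
      then \<Sum>d \<in> (\<Pi>\<^sub>E i\<in>{1..r}. {d. d dvd n i}). F d * H (\<lambda>i\<in>{1..r}. n i div d i)
      else 0)"

definition fds_prod :: "nat \<Rightarrow> ('a \<Rightarrow> fds) \<Rightarrow> 'a set \<Rightarrow> fds" where
  "fds_prod r F A = Finite_Set.fold (\<lambda>k. fds_mult r (F k)) (fds_one r) A"

text \<open>
  Unordered infinite product: every coefficient of the finite partial products is eventually
  constant, with the corresponding coefficient of \<open>P\<close> as its value.
\<close>

definition fds_has_prod :: "nat \<Rightarrow> ('a \<Rightarrow> fds) \<Rightarrow> 'a set \<Rightarrow> fds \<Rightarrow> bool" where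
  "fds_has_prod r F A P \<longleftrightarrow>
     (\<forall>n. eventually (\<lambda>S. fds_prod r F S n = P n) (finite_subsets_at_top A))"

text \<open>The one-variable series \<open>D(f, s\<^sub>i)\<close>, regarded as a series in \<open>s\<^sub>1, \<dots>, s\<^sub>r\<close>.\<close>

definition fds_D :: "nat \<Rightarrow> nat \<Rightarrow> (nat \<Rightarrow> complex) \<Rightarrow> fds" where
  "fds_D r i f n =
     (if n \<in> tuples r \<and> (\<forall>j\<in>{1..r}. j \<noteq> i \<longrightarrow> n j = 1) then f (n i) else 0)"

definition fds_coprime :: "nat \<Rightarrow> (nat \<Rightarrow> nat \<Rightarrow> complex) \<Rightarrow> fds" where
  "fds_coprime r f n = (if n \<in> coprime_tuples r then \<Prod>i\<in>{1..r}. f i (n i) else 0)"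

text \<open>
  The formal counterpart of \<^const>\<open>euler_factor\<close>: the power of \<open>p\<close> with exponent
  \<open>- (\<Sum>l\<in>L. a\<^sub>l s\<^sub>l)\<close> is the monomial of the tuple with entry \<open>p ^ a\<^sub>l\<close> at \<open>l \<in> L\<close> and 1 elsewhere.
\<close>

definition fds_euler_factor ::
    "nat \<Rightarrow> nat \<Rightarrow> (nat \<Rightarrow> nat \<Rightarrow> nat \<Rightarrow> complex) \<Rightarrow> nat \<Rightarrow> fds" where
  "fds_euler_factor r t g p n =
     fds_one r n -
     (\<Sum>i=2..r. (of_nat i - 1) *
        (\<Sum>L | L \<subseteq> {1..r} \<and> card L = i. \<Sum>a\<in>L \<rightarrow>\<^sub>E {1..t}.
           fds_monom r (\<lambda>l. if l \<in> L then p ^ a l else 1) n *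
           (\<Prod>l\<in>L. (- 1) ^ a l * G g t l (a l) p)))"

text \<open>The fold in \<^const>\<open>fds_prod\<close> does not depend on the order of the factors.\<close>

lemma fds_mult_left_commute:
  "fds_mult r F (fds_mult r H K) = fds_mult r H (fds_mult r F K)"
proof
  fix n :: "nat \<Rightarrow> nat"
  define I where "I = {1..r}"
  define Dv where "Dv = (\<lambda>m::nat \<Rightarrow> nat. \<Pi>\<^sub>E i\<in>I. {d. d dvd m i})"
  define q where "q = (\<lambda>(m::nat \<Rightarrow> nat) d. \<lambda>i\<in>I. m i div d i)"
  show "fds_mult r F (fds_mult r H K) n = fds_mult r H (fds_mult r F K) n"
  proof (cases "n \<in> tuples r")
    case n: True
    have tuplesD: "m i > 0" if "m \<in> tuples r" "i \<in> I" for m i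
      using PiE_mem[OF that[unfolded tuples_def I_def]] by simp
    have npos: "n i > 0" if "i \<in> I" for i
      using tuplesD n that .
    have DvD: "d i dvd m i" if "d \<in> Dv m" "i \<in> I" for d m i
      using PiE_mem[OF that[unfolded Dv_def]] by simp
    have qt: "q n d \<in> tuples r" if "d \<in> Dv n" for d
    proof -
      have "n i div d i \<ge> 1" if "i \<in> I" for i
        using DvD[OF \<open>d \<in> Dv n\<close> that] npos[OF that] by (auto elim!: dvdE)
      then show ?thesis unfolding tuples_def q_def I_def by auto
    qed
    have fin: "finite (Dv m)" if "\<And>i. i \<in> I \<Longrightarrow> m i > 0" for m
      unfolding Dv_def using that by (intro finite_PiE) (auto simp: I_def)
    have finn: "finite (Dv n)" using fin npos by blast
    have finq: "finite (Dv (q n d))" if "d \<in> Dv n" for d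
      using tuplesD[OF qt[OF that]] by (rule fin)
    have expand: "fds_mult r A (fds_mult r B K) n =
        (\<Sum>(d, e)\<in>(SIGMA d:Dv n. Dv (q n d)). A d * (B e * K (q (q n d) e)))" for A B
    proof -
      have "fds_mult r A (fds_mult r B K) n = (\<Sum>d\<in>Dv n. A d * fds_mult r B K (q n d))"
        using n by (simp add: fds_mult_def Dv_def q_def I_def)
      also have "\<dots> = (\<Sum>d\<in>Dv n. \<Sum>e\<in>Dv (q n d). A d * (B e * K (q (q n d) e)))"
        using qt by (intro sum.cong refl)
          (simp add: fds_mult_def Dv_def q_def I_def sum_distrib_left)
      also have "\<dots> = (\<Sum>(d, e)\<in>(SIGMA d:Dv n. Dv (q n d)). A d * (B e * K (q (q n d) e)))"
        using finn finq by (intro sum.Sigma) auto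
      finally show ?thesis .
    qed
    have swap: "e \<in> Dv n \<and> d \<in> Dv (q n e)" if "d \<in> Dv n" "e \<in> Dv (q n d)" for d e
    proof -
      have *: "e i dvd n i \<and> d i dvd n i div e i" if "i \<in> I" for i
      proof -
        have d: "d i dvd n i" and e: "e i dvd n i div d i"
          using DvD[OF \<open>d \<in> Dv n\<close> that] DvD[OF \<open>e \<in> Dv (q n d)\<close> that] that
          by (auto simp: q_def)
        from e obtain k where "n i div d i = e i * k" ..
        with dvd_mult_div_cancel[OF d] have k: "n i = e i * (d i * k)"
          by (simp add: mult.left_commute)
        moreover have "e i > 0" using k npos[OF that] by (cases "e i") auto
        ultimately have "n i div e i = d i * k" by simp
        with k show ?thesis by simp
      qed
      show ?thesis using that * unfolding Dv_def q_def by (auto simp: PiE_iff)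
    qed
    have qq: "q (q n d) e = q (q n e) d" for d e
    proof -
      have "a div b div c = a div c div b" for a b c :: nat
        by (metis div_mult2_eq mult.commute)
      then show ?thesis by (simp add: q_def fun_eq_iff)
    qed
    define X where "X = (SIGMA d:Dv n. Dv (q n d))"
    have X: "prod.swap x \<in> X" if "x \<in> X" for x
      using swap[of "fst x" "snd x"] that unfolding X_def by (cases x) simp
    have eq: "F (fst x) * (H (snd x) * K (q (q n (fst x)) (snd x))) =
          H (snd x) * (F (fst x) * K (q (q n (snd x)) (fst x)))" for x
      by (simp only: qq[of "fst x" "snd x"] mult.left_commute)
    show ?thesis
      unfolding expand X_def[symmetric] case_prod_beta
      by (intro sum.reindex_bij_witness[where i = prod.swap and j = prod.swap])
         (simp_all only: X swap_swap fst_swap snd_swap eq)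
  qed (simp add: fds_mult_def)
qed

lemma fds_prod_empty: "fds_prod r F {} = fds_one r"
  by (simp add: fds_prod_def)

lemma fds_prod_insert:
  assumes "finite A" "k \<notin> A"
  shows "fds_prod r F (insert k A) = fds_mult r (F k) (fds_prod r F A)"
proof -
  interpret comp_fun_commute "\<lambda>k. fds_mult r (F k)"
    by standard (simp add: fun_eq_iff fds_mult_left_commute)
  show ?thesis using assms by (simp add: fds_prod_def)
qed

end

theory Submission
  imports Defs "HOL-Computational_Algebra.Formal_Power_Series"
begin

text \<open>
  Write \<open>y\<^sub>i(a) = (-1)\<^sup>a G\<^sub>i\<^sub>a(p)\<close>, so that \<open>\<Sum> y\<^sub>i(a) X\<^sup>a\<close> is the inverse of the Bell series of
  \<open>f\<^sub>i\<close> at \<open>p\<close>. The coefficient of the Euler factor at the tuple \<open>(p\<^bsup>e\<^sub>1\<^esup>, \<dots>, p\<^bsup>e\<^sub>r\<^esup>)\<close> is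
  \<open>(1 - |supp e|) \<Prod> y\<^sub>i(e\<^sub>i)\<close>, and convolving it with \<open>\<Prod> f\<^sub>i(p\<^bsup>e\<^sub>i\<^esup>)\<close> leaves exactly the tuples
  with at most one nontrivial entry. By multiplicativity this local identity extends to the series
  restricted to \<open>S\<close>-smooth tuples for every finite set \<open>S\<close> of primes. The formal identity is read
  off with \<open>S\<close> the set of primes dividing a given tuple. For the analytic identity, evaluate the
  \<open>S\<close>-smooth identity, whose Euler product is finite, and let \<open>S\<close> exhaust the primes; thus no
  convergence of local series or of the formal coefficients of the Euler product is needed.
\<close>

section \<open>Multiplicativity of Dirichlet convolutions\<close>

text \<open>The condition \<open>f 1 = 1\<close> replaces the usual requirement that
  \<open>f\<close> be nonzero, and is the form in which trivial entries of tuples are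
  evaluated.\<close>

definition multiplicative :: "(nat \<Rightarrow> complex) \<Rightarrow> bool" where
  "multiplicative f \<longleftrightarrow> f 1 = 1 \<and> (\<forall>m\<ge>1. \<forall>n\<ge>1. coprime m n \<longrightarrow> f (m * n) = f m * f n)"

lemma completely_mult_one: "completely_mult g \<Longrightarrow> g 1 = 1"
  unfolding completely_mult_def by (metis mult.right_neutral mult_cancel_left order_refl)

lemma completely_mult_power:
  assumes "completely_mult g" "p \<ge> 1"
  shows "g (p ^ k) = g p ^ k"
proof (induction k)
  case 0
  then show ?case using completely_mult_one[OF assms(1)] by simp
next
  case (Suc k)
  have "p ^ k \<ge> 1" using assms(2) by simp
  then show ?case using Suc assms unfolding completely_mult_def by simp
qed

lemma completely_mult_imp_multiplicative: "completely_mult g \<Longrightarrow> multiplicative g"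
  using completely_mult_one unfolding multiplicative_def completely_mult_def by blast

text \<open>For coprime \<open>m\<close> and \<open>n\<close>, a divisor of \<open>m * n\<close> is
  in exactly one way a divisor of \<open>m\<close> times a divisor of \<open>n\<close>, and
  \<open>gcd\<close> with \<open>m\<close> and \<open>n\<close> recovers the two parts. The divisor
  sum therefore becomes a sum over pairs, which factors.\<close>

lemma multiplicative_dconv:
  assumes f: "multiplicative f" and g: "multiplicative g"
  shows "multiplicative (dconv f g)"
  unfolding multiplicative_def
proof (intro conjI allI impI)
  show "dconv f g 1 = 1"
    using f g by (simp add: dconv_def multiplicative_def)
next
  fix m n :: nat
  assume m: "m \<ge> 1" and n: "n \<ge> 1" and cop: "coprime m n"
  define D where "D = (\<lambda>k::nat. {d. d dvd k})"
  have fm: "f (a * b) = f a * f b" if "a dvd m" "b dvd n" for a b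
  proof -
    have "a \<ge> 1" "b \<ge> 1" using that m n dvd_pos_nat[of m a] dvd_pos_nat[of n b] by simp_all
    moreover have "coprime a b" using cop that by (metis coprime_divisors)
    ultimately show ?thesis using f unfolding multiplicative_def by blast
  qed
  have gm: "g (a * b) = g a * g b" if "a dvd m" "b dvd n" for a b
  proof -
    have "a \<ge> 1" "b \<ge> 1" using that m n dvd_pos_nat[of m a] dvd_pos_nat[of n b] by simp_all
    moreover have "coprime a b" using cop that by (metis coprime_divisors)
    ultimately show ?thesis using g unfolding multiplicative_def by blast
  qed
  have gcd1: "gcd (a * b) m = a" if "a dvd m" "b dvd n" for a b
  proof -
    have "coprime b m" using cop that by (metis coprime_divisors coprime_commute dvd_refl)
    then have "gcd m (a * b) = gcd m a"
      by (intro gcd_mult_right_right_cancel) (simp add: coprime_commute)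
    then show ?thesis using that(1) by (metis gcd.commute gcd_nat.absorb1)
  qed
  have gcd2: "gcd (a * b) n = b" if "a dvd m" "b dvd n" for a b
  proof -
    have "coprime a n" using cop that by (metis coprime_divisors dvd_refl)
    then have "gcd n (a * b) = gcd n b"
      by (intro gcd_mult_right_left_cancel) (simp add: coprime_commute)
    then show ?thesis using that(2) by (metis gcd.commute gcd_nat.absorb1)
  qed
  have "dconv f g (m * n) = (\<Sum>(a,b)\<in>D m \<times> D n. f (a * b) * g ((m * n) div (a * b)))"
    unfolding dconv_def D_def case_prod_beta
  proof (rule sum.reindex_bij_witness[where i = "\<lambda>x. fst x * snd x" and j = "\<lambda>d. (gcd d m, gcd d n)"])
    fix d assume "d \<in> {d. d dvd m * n}"
    then have d: "d dvd m * n" by simp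
    obtain a b where "d = a * b" "a dvd m" "b dvd n"
      using division_decomp[OF d] by blast
    then have "gcd d m * gcd d n = d"
      by (simp add: gcd1 gcd2)
    then show "fst (gcd d m, gcd d n) * snd (gcd d m, gcd d n) = d"
      and "f (fst (gcd d m, gcd d n) * snd (gcd d m, gcd d n)) *
         g (m * n div (fst (gcd d m, gcd d n) * snd (gcd d m, gcd d n))) = f d * g (m * n div d)"
      by simp_all
  qed (auto simp: gcd1 gcd2 mult_dvd_mono)
  also have "\<dots> = (\<Sum>(a,b)\<in>D m \<times> D n. (f a * g (m div a)) * (f b * g (n div b)))"
  proof (intro sum.cong refl, clarify)
    fix a b assume "a \<in> D m" "b \<in> D n"
    then have ab: "a dvd m" "b dvd n" by (auto simp: D_def)
    then have "(m * n) div (a * b) = (m div a) * (n div b)" by (simp add: div_mult_div_if_dvd)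
    moreover have "m div a dvd m" "n div b dvd n" using ab by (metis dvd_mult_div_cancel dvd_triv_right)+
    ultimately show "f (a * b) * g (m * n div (a * b)) = f a * g (m div a) * (f b * g (n div b))"
      using fm[OF ab] gm[of "m div a" "n div b"] by simp
  qed
  also have "\<dots> = dconv f g m * dconv f g n"
    by (simp add: dconv_def D_def sum_product sum.cartesian_product)
  finally show "dconv f g (m * n) = dconv f g m * dconv f g n" .
qed

lemma multiplicative_dconv_upto:
  assumes "\<And>j. j \<in> {1..t} \<Longrightarrow> completely_mult (h j)"
  shows "multiplicative (dconv_upto h t)"
  using assms
proof (induction t)
  case 0
  then show ?case by (auto simp: multiplicative_def)
next
  case (Suc t)
  then show ?case by (simp add: multiplicative_dconv completely_mult_imp_multiplicative)
qed

section \<open>The Bell series of a convolution\<close>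

text \<open>On the powers of one prime, Dirichlet convolution is the Cauchy product; this is the
  passage to formal power series.\<close>

lemma dconv_prime_power:
  assumes p: "prime p"
  shows "dconv f g (p ^ k) = (\<Sum>a=0..k. f (p ^ a) * g (p ^ (k - a)))"
proof -
  have "{d. d dvd p ^ k} = (\<lambda>a. p ^ a) ` {0..k}"
    using p by (auto simp: divides_primepow_nat)
  moreover have "inj_on (\<lambda>a. p ^ a) {0..k}"
    using prime_gt_1_nat[OF p] by (auto intro!: inj_onI)
  moreover have "p ^ k div p ^ a = p ^ (k - a)" if "a \<le> k" for a
    using that p by (simp add: power_diff prime_gt_0_nat)
  ultimately show ?thesis
    by (simp add: dconv_def sum.reindex)
qed

text \<open>A completely multiplicative function has a geometric Bell series, inverse to a linear
  polynomial, and convolution multiplies Bell series.\<close>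

lemma bell_series_dconv_upto:
  assumes "\<And>j. j \<in> {1..t} \<Longrightarrow> completely_mult (h j)" and p: "prime p"
  shows "Abs_fps (\<lambda>k. dconv_upto h t (p ^ k)) * (\<Prod>j\<in>{1..t}. 1 - fps_const (h j p) * fps_X) = 1"
  using assms(1)
proof (induction t)
  case 0
  have "p ^ k = Suc 0 \<longleftrightarrow> k = 0" for k
    using prime_gt_1_nat[OF p] by simp
  then show ?case by (intro fps_ext) simp
next
  case (Suc t)
  define c where "c = h (Suc t) p"
  have cm: "completely_mult (h (Suc t))" using Suc.prems by simp
  have "Abs_fps (\<lambda>k. dconv_upto h (Suc t) (p ^ k)) =
      Abs_fps (\<lambda>k. dconv_upto h t (p ^ k)) * Abs_fps (\<lambda>k. c ^ k)"
    using completely_mult_power[OF cm] prime_ge_1_nat[OF p]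
    by (intro fps_ext) (simp add: dconv_prime_power[OF p] fps_mult_nth c_def)
  moreover have "Abs_fps (\<lambda>k. c ^ k) * (1 - fps_const c * fps_X) = 1"
  proof (rule fps_ext)
    fix n
    show "fps_nth (Abs_fps (\<lambda>k. c ^ k) * (1 - fps_const c * fps_X)) n = fps_nth 1 n"
      by (cases n) (simp_all add: right_diff_distrib mult.assoc[symmetric] mult.commute[of c])
  qed
  moreover have "(\<Prod>j\<in>{1..Suc t}. 1 - fps_const (h j p) * fps_X) =
      (\<Prod>j\<in>{1..t}. 1 - fps_const (h j p) * fps_X) * (1 - fps_const c * fps_X)"
    by (simp add: c_def)
  moreover have "Abs_fps (\<lambda>k. dconv_upto h t (p ^ k)) * (\<Prod>j\<in>{1..t}. 1 - fps_const (h j p) * fps_X) = 1"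
    using Suc by simp
  ultimately show ?case
    by (metis (no_types, lifting) mult.assoc mult.left_commute mult.right_neutral)
qed

text \<open>In the expansion of the product, choosing the linear term exactly for the indices in
  \<open>L\<close> gives a multiple of \<open>fps_X ^ card L\<close>. Degree \<open>a\<close> thus
  collects the sets of size \<open>a\<close>, with sign \<open>(- 1) ^ a\<close>.\<close>

lemma fps_nth_prod_G:
  "fps_nth (\<Prod>j\<in>{1..t}. 1 - fps_const (g i j p) * fps_X) a = (- 1) ^ a * G g t i a p"
proof -
  \<comment> \<open>Absorbing the sign into \<open>u\<close> gives the factors the shape
    \<open>fps_const (u j) * fps_X + 1\<close> that \<open>prod_add\<close> expands.\<close>
  define u where "u = (\<lambda>j. - g i j p)"
  have *: "(\<Prod>j\<in>L. fps_const (u j) * fps_X) = fps_const (\<Prod>j\<in>L. u j) * fps_X ^ card L"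
    if "finite L" for L
    using that by (induction rule: finite_induct) (simp_all add: mult_ac fps_const_mult[symmetric] del: fps_const_mult)
  have "(\<Prod>j\<in>{1..t}. 1 - fps_const (g i j p) * fps_X) = (\<Prod>j\<in>{1..t}. fps_const (u j) * fps_X + 1)"
    by (intro prod.cong refl) (simp add: u_def fps_const_neg[symmetric] del: fps_const_neg)
  also have "\<dots> = (\<Sum>L\<in>Pow {1..t}. \<Prod>j\<in>L. fps_const (u j) * fps_X)"
    by (subst prod_add) simp_all
  also have "\<dots> = (\<Sum>L\<in>Pow {1..t}. fps_const (\<Prod>j\<in>L. u j) * fps_X ^ card L)"
    by (intro sum.cong refl *) (auto intro: finite_subset)
  finally have "fps_nth (\<Prod>j\<in>{1..t}. 1 - fps_const (g i j p) * fps_X) a =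
      (\<Sum>L\<in>Pow {1..t}. if a = card L then (\<Prod>j\<in>L. u j) else 0)"
    by (simp add: fps_sum_nth if_distrib[of "(*) _"] cong: if_cong)
  also have "\<dots> = (\<Sum>L | L \<subseteq> {1..t} \<and> card L = a. (- 1) ^ a * (\<Prod>j\<in>L. g i j p))"
    by (rule sum.mono_neutral_cong_right) (auto simp: u_def prod_uminus)
  finally show ?thesis by (simp add: G_def sum_distrib_left)
qed

text \<open>The inverse relation read coefficient by coefficient. Together with multiplicativity,
  this is how the convolution structure of \<open>f\<close> enters the rest of the proof.\<close>

lemma dconv_upto_convolution_G:
  assumes "\<And>j. j \<in> {1..t} \<Longrightarrow> completely_mult (g i j)" and p: "prime p"
  shows "(\<Sum>a\<le>k. dconv_upto (g i) t (p ^ a) * ((- 1) ^ (k - a) * G g t i (k - a) p)) =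
    (if k = 0 then 1 else 0)"
proof -
  have "Abs_fps (\<lambda>k. dconv_upto (g i) t (p ^ k)) * (\<Prod>j\<in>{1..t}. 1 - fps_const (g i j p) * fps_X) = 1"
    using assms by (rule bell_series_dconv_upto)
  from arg_cong[OF this, of "\<lambda>F. fps_nth F k"] show ?thesis
    by (simp only: fps_mult_nth fps_nth_prod_G atMost_atLeast0 fps_one_nth fps_nth_Abs_fps)
qed

lemma G_0 [simp]: "G g t i 0 p = 1"
proof -
  have "{L. L \<subseteq> {1..t} \<and> card L = 0} = {{}}"
    using finite_subset[of _ "{1..t}"] by auto
  then show ?thesis by (simp add: G_def)
qed

text \<open>Reconciles the bound \<open>t\<close> on the exponents in the Euler factor with tuples
  of arbitrary prime powers: larger exponents carry the coefficient 0.\<close>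

lemma G_eq_0:
  assumes "a > t"
  shows "G g t i a p = 0"
proof -
  have "card L \<le> t" if "L \<subseteq> {1..t}" for L
    using card_mono[OF _ that] by simp
  then have "{L. L \<subseteq> {1..t} \<and> card L = a} = {}"
    using assms by (auto simp: not_le[symmetric])
  then show ?thesis by (simp only: G_def sum.empty)
qed

section \<open>The ring of formal Dirichlet series in several variables\<close>

text \<open>The trivial entry of a tuple is written \<open>1\<close>; the simplifier is kept from
  turning it into \<open>Suc 0\<close>.\<close>

declare One_nat_def [simp del]

text \<open>The restriction keeps tuples extensional, so that tuples agreeing on
  \<open>{1..r}\<close> are equal as functions.\<close>

definition tmult :: "nat \<Rightarrow> (nat \<Rightarrow> nat) \<Rightarrow> (nat \<Rightarrow> nat) \<Rightarrow> nat \<Rightarrow> nat" where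
  "tmult r m k = (\<lambda>i\<in>{1..r}. m i * k i)"

definition tdiv :: "nat \<Rightarrow> (nat \<Rightarrow> nat) \<Rightarrow> (nat \<Rightarrow> nat) \<Rightarrow> nat \<Rightarrow> nat" where
  "tdiv r n d = (\<lambda>i\<in>{1..r}. n i div d i)"

definition tdivisors :: "nat \<Rightarrow> (nat \<Rightarrow> nat) \<Rightarrow> (nat \<Rightarrow> nat) set" where
  "tdivisors r n = (\<Pi>\<^sub>E i\<in>{1..r}. {d. d dvd n i})"

lemma tuples_gt_0: "n \<in> tuples r \<Longrightarrow> i \<in> {1..r} \<Longrightarrow> n i > 0"
  using PiE_mem[of n "{1..r}" "\<lambda>_. {1..}" i] unfolding tuples_def by simp

lemma tuplesI: "n \<in> extensional {1..r} \<Longrightarrow> (\<And>i. i \<in> {1..r} \<Longrightarrow> n i > 0) \<Longrightarrow> n \<in> tuples r"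
  unfolding tuples_def PiE_def Pi_def by (auto simp: Suc_le_eq One_nat_def)

lemma tuples_extensional: "n \<in> tuples r \<Longrightarrow> n \<in> extensional {1..r}"
  unfolding tuples_def by (simp add: PiE_def)

lemma tdivisors_dvd: "d \<in> tdivisors r n \<Longrightarrow> i \<in> {1..r} \<Longrightarrow> d i dvd n i"
  using PiE_mem[of d "{1..r}" "\<lambda>i. {d. d dvd n i}" i] unfolding tdivisors_def by simp

lemma tdivisors_extensional: "d \<in> tdivisors r n \<Longrightarrow> d \<in> extensional {1..r}"
  unfolding tdivisors_def by (simp add: PiE_def)

lemma tdivisorsI:
  "d \<in> extensional {1..r} \<Longrightarrow> (\<And>i. i \<in> {1..r} \<Longrightarrow> d i dvd n i) \<Longrightarrow> d \<in> tdivisors r n"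
  unfolding tdivisors_def by (simp add: PiE_def Pi_def)

lemma tdivisors_tuples:
  assumes "n \<in> tuples r" "d \<in> tdivisors r n"
  shows "d \<in> tuples r"
proof (rule tuplesI)
  fix i assume "i \<in> {1..r}"
  then show "d i > 0"
    using dvd_pos_nat[OF tuples_gt_0[OF assms(1)] tdivisors_dvd[OF assms(2)]] by simp
qed (use assms tdivisors_extensional in blast)

lemma finite_tdivisors: "n \<in> tuples r \<Longrightarrow> finite (tdivisors r n)"
  unfolding tdivisors_def by (intro finite_PiE) (auto dest: tuples_gt_0)

lemma tdiv_extensional [simp]: "tdiv r n d \<in> extensional {1..r}"
  unfolding tdiv_def by simp

lemma tmult_extensional [simp]: "tmult r n d \<in> extensional {1..r}"
  unfolding tmult_def by simp

lemma tmult_tuples: "m \<in> tuples r \<Longrightarrow> k \<in> tuples r \<Longrightarrow> tmult r m k \<in> tuples r"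
  by (rule tuplesI) (simp_all add: tmult_def tuples_gt_0)

lemma tdiv_tdivisors: "d \<in> tdivisors r n \<Longrightarrow> tdiv r n d \<in> tdivisors r n"
proof (rule tdivisorsI)
  fix i assume "d \<in> tdivisors r n" "i \<in> {1..r}"
  then show "tdiv r n d i dvd n i"
    using tdivisors_dvd[of d r n i] by (simp add: tdiv_def) (metis dvd_mult_div_cancel dvd_triv_right)
qed simp

lemma tmult_tdiv:
  assumes "n \<in> tuples r" "d \<in> tdivisors r n"
  shows "tmult r d (tdiv r n d) = n"
proof (rule extensionalityI)
  fix i assume "i \<in> {1..r}"
  then show "tmult r d (tdiv r n d) i = n i"
    using tdivisors_dvd[OF assms(2)] by (simp add: tmult_def tdiv_def)
qed (use assms tuples_extensional in auto)

lemma tdiv_tuples: "n \<in> tuples r \<Longrightarrow> d \<in> tdivisors r n \<Longrightarrow> tdiv r n d \<in> tuples r"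
  using tdivisors_tuples tdiv_tdivisors by blast

lemma tmult_tdivisors:
  assumes "d \<in> tuples r"
  shows "d \<in> tdivisors r (tmult r d k)"
  using assms by (intro tdivisorsI tuples_extensional) (simp_all add: tmult_def)

lemma tdiv_tmult:
  assumes "d \<in> tuples r" "k \<in> tuples r"
  shows "tdiv r (tmult r d k) d = k"
proof (rule extensionalityI)
  fix i assume "i \<in> {1..r}"
  then show "tdiv r (tmult r d k) d i = k i"
    using tuples_gt_0[OF assms(1)] by (simp add: tmult_def tdiv_def)
qed (use assms tuples_extensional in auto)

lemma tmult_commute: "tmult r m k = tmult r k m"
  by (simp add: tmult_def mult.commute)

lemma tdiv_tdiv:
  assumes "n \<in> tuples r" "d \<in> tdivisors r n"
  shows "tdiv r n (tdiv r n d) = d"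
  by (metis assms tdiv_tmult tdiv_tuples tdivisors_tuples tmult_commute tmult_tdiv)

section \<open>Convolution of coefficient functions on tuples\<close>

lemma fds_mult_eq:
  "n \<in> tuples r \<Longrightarrow> fds_mult r F H n = (\<Sum>d\<in>tdivisors r n. F d * H (tdiv r n d))"
  by (simp add: fds_mult_def tdivisors_def tdiv_def)

lemma fds_mult_outside: "n \<notin> tuples r \<Longrightarrow> fds_mult r F H n = 0"
  by (simp add: fds_mult_def)

text \<open>Passing to the complementary divisor \<open>tdiv r n d\<close> is an involution on the
  divisors of \<open>n\<close> that exchanges the roles of the two factors.\<close>

lemma fds_mult_commute: "fds_mult r F H = fds_mult r H F"
proof
  fix n
  show "fds_mult r F H n = fds_mult r H F n"
  proof (cases "n \<in> tuples r")
    case True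
    then show ?thesis unfolding fds_mult_eq[OF True]
      by (intro sum.reindex_bij_witness[where i = "tdiv r n" and j = "tdiv r n"])
        (auto simp: tdiv_tdiv tdiv_tdivisors)
  qed (simp add: fds_mult_outside)
qed

text \<open>When a prime is added to \<open>S\<close>, this separates the smooth series from the
  Euler factors. It follows from commutativity and \<open>fds_mult_left_commute\<close>.\<close>

lemma fds_mult_mult_swap:
  "fds_mult r (fds_mult r F H) (fds_mult r F' H') = fds_mult r (fds_mult r F F') (fds_mult r H H')"
proof -
  have "fds_mult r (fds_mult r F H) (fds_mult r F' H') = fds_mult r F' (fds_mult r H' (fds_mult r F H))"
    by (metis fds_mult_commute fds_mult_left_commute)
  also have "\<dots> = fds_mult r (fds_mult r F F') (fds_mult r H H')"
    by (metis fds_mult_commute fds_mult_left_commute)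
  finally show ?thesis .
qed

definition tone :: "nat \<Rightarrow> nat \<Rightarrow> nat" where
  "tone r = (\<lambda>i\<in>{1..r}. 1)"

lemma tone_tuples [simp]: "tone r \<in> tuples r"
  by (rule tuplesI) (simp_all add: tone_def)

lemma fds_one_eq: "fds_one r n = (if n = tone r then 1 else 0)"
  by (simp add: fds_one_def fds_monom_def tone_def)

lemma tdiv_tone: "n \<in> tuples r \<Longrightarrow> tdiv r n (tone r) = n"
  by (rule extensionalityI[of _ "{1..r}"]) (auto simp: tdiv_def tone_def tuples_extensional)

text \<open>Meant for products in which only one factorization of \<open>n\<close> contributes:
  multiplication by the unit, separation of one prime, separation of one variable.\<close>

lemma fds_mult_single:
  assumes n: "n \<in> tuples r" and d: "d \<in> tdivisors r n"
    and zero: "\<And>d'. d' \<in> tdivisors r n \<Longrightarrow> d' \<noteq> d \<Longrightarrow> F d' * H (tdiv r n d') = 0"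
  shows "fds_mult r F H n = F d * H (tdiv r n d)"
proof -
  have "fds_mult r F H n = (\<Sum>d'\<in>{d}. F d' * H (tdiv r n d'))"
    unfolding fds_mult_eq[OF n] using assms by (intro sum.mono_neutral_right finite_tdivisors) auto
  then show ?thesis by simp
qed

lemma tone_tdivisors [simp]: "tone r \<in> tdivisors r n"
  by (rule tdivisorsI) (auto simp: tone_def)

text \<open>The restriction to tuples matters because \<open>fds_mult\<close> vanishes elsewhere,
  while \<open>F\<close> is arbitrary there.\<close>

lemma fds_mult_one_left:
  assumes "n \<in> tuples r"
  shows "fds_mult r (fds_one r) F n = F n"
  using assms by (subst fds_mult_single[where d = "tone r"]) (auto simp: fds_one_eq tdiv_tone)

section \<open>Restriction to smooth tuples\<close>

definition smooth :: "nat \<Rightarrow> nat set \<Rightarrow> (nat \<Rightarrow> nat) set" where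
  "smooth r S = {n \<in> tuples r. \<forall>i\<in>{1..r}. \<forall>q. prime q \<longrightarrow> q dvd n i \<longrightarrow> q \<in> S}"

text \<open>For multiplicative \<open>F\<close> and a finite set \<open>S\<close> of primes, this
  truncation plays the role of the partial Euler product over \<open>S\<close>.\<close>

definition fds_smooth :: "nat \<Rightarrow> nat set \<Rightarrow> fds \<Rightarrow> fds" where
  "fds_smooth r S F n = (if n \<in> smooth r S then F n else 0)"

text \<open>Every entry of \<open>m\<close> has to be coprime to every entry of \<open>k\<close>,
  not just to the one at the same position: otherwise a product of two pairwise coprime tuples, such
  as (2,1) and (1,2), could fail to be pairwise coprime.\<close>

definition tmultiplicative :: "nat \<Rightarrow> fds \<Rightarrow> bool" where
  "tmultiplicative r F \<longleftrightarrow> F (tone r) = 1 \<and>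
     (\<forall>m\<in>tuples r. \<forall>k\<in>tuples r. (\<forall>i\<in>{1..r}. \<forall>j\<in>{1..r}. coprime (m i) (k j)) \<longrightarrow>
        F (tmult r m k) = F m * F k)"

lemma smooth_tuples: "n \<in> smooth r S \<Longrightarrow> n \<in> tuples r"
  by (simp add: smooth_def)

lemma smoothD: "n \<in> smooth r S \<Longrightarrow> i \<in> {1..r} \<Longrightarrow> prime q \<Longrightarrow> q dvd n i \<Longrightarrow> q \<in> S"
  by (simp add: smooth_def)

lemma smoothI:
  "n \<in> tuples r \<Longrightarrow> (\<And>i q. i \<in> {1..r} \<Longrightarrow> prime q \<Longrightarrow> q dvd n i \<Longrightarrow> q \<in> S) \<Longrightarrow> n \<in> smooth r S"
  by (simp add: smooth_def)

lemma smooth_tmult: "m \<in> smooth r S \<Longrightarrow> k \<in> smooth r T \<Longrightarrow> tmult r m k \<in> smooth r (S \<union> T)"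
  using tmult_tuples by (auto simp: smooth_def tmult_def prime_dvd_mult_iff)

lemma smooth_coprime:
  assumes "m \<in> smooth r S" "k \<in> smooth r T" "S \<inter> T = {}" "i \<in> {1..r}" "j \<in> {1..r}"
  shows "coprime (m i) (k j)"
proof (rule ccontr)
  assume "\<not> coprime (m i) (k j)"
  then obtain q where "prime q" "q dvd m i" "q dvd k j"
    using prime_factor_nat[of "gcd (m i) (k j)"] by (auto simp: coprime_iff_gcd_eq_1)
  then show False
    using smoothD[OF assms(1,4)] smoothD[OF assms(2,5)] assms(3) by blast
qed

lemma smooth_tdivisors:
  assumes "n \<in> smooth r S" "d \<in> tdivisors r n"
  shows "d \<in> smooth r S"
  using assms tdivisors_tuples unfolding smooth_def by (blast intro: dvd_trans tdivisors_dvd)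

lemma smooth_singleton:
  assumes p: "prime p"
  shows "smooth r {p} = {\<lambda>i\<in>{1..r}. p ^ e i | e. True}"
proof (intro set_eqI iffI)
  fix n assume n: "n \<in> smooth r {p}"
  have "n i = p ^ multiplicity p (n i)" if i: "i \<in> {1..r}" for i
  proof -
    have "n i > 0" using n i tuples_gt_0 smooth_tuples by blast
    then obtain y where y: "n i = p ^ multiplicity p (n i) * y" "\<not> p dvd y"
      using multiplicity_decompose'[of "n i" p] p by (metis not_prime_unit gr_implies_not0)
    have "y = 1"
    proof (rule ccontr)
      assume "y \<noteq> 1"
      then obtain q where q: "prime q" "q dvd y" using prime_factor_nat by blast
      then have "q dvd n i" using y(1) by (metis dvd_mult)
      then have "q = p" using n i q by (auto simp: smooth_def)
      then show False using q y by simp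
    qed
    then show ?thesis using y(1) by simp
  qed
  then have "n = (\<lambda>i\<in>{1..r}. p ^ multiplicity p (n i))"
    using n tuples_extensional smooth_tuples by (intro extensionalityI[of _ "{1..r}"]) auto
  then show "n \<in> {\<lambda>i\<in>{1..r}. p ^ e i | e. True}"
    by (intro CollectI exI[of _ "\<lambda>i. multiplicity p (n i)"]) simp
next
  fix n assume "n \<in> {\<lambda>i\<in>{1..r}. p ^ e i | e. True}"
  then obtain e where e: "n = (\<lambda>i\<in>{1..r}. p ^ e i)" by blast
  have "n \<in> tuples r" using prime_gt_0_nat[OF p] by (intro tuplesI) (simp_all add: e)
  moreover have "q = p" if "prime q" "q dvd p ^ k" for q k
    using that p by (metis prime_dvd_power primes_dvd_imp_eq)
  ultimately show "n \<in> smooth r {p}" by (auto simp: smooth_def e)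
qed

text \<open>Each tuple on the left splits uniquely into an \<open>S\<close>-smooth part and a part
  made of powers of \<open>p\<close>. So the convolution has one nonzero term, to which
  multiplicativity applies.\<close>

lemma fds_smooth_insert:
  assumes F: "tmultiplicative r F" and p: "prime p" and pS: "p \<notin> S"
  shows "fds_smooth r (insert p S) F = fds_mult r (fds_smooth r S F) (fds_smooth r {p} F)"
proof
  fix n
  show "fds_smooth r (insert p S) F n = fds_mult r (fds_smooth r S F) (fds_smooth r {p} F) n"
  proof (cases "n \<in> smooth r (insert p S)")
    case True
    then have n: "n \<in> tuples r" by (rule smooth_tuples)
    \<comment> \<open>The \<open>S\<close>-smooth part is obtained by stripping all powers of
      \<open>p\<close> from every entry.\<close>
    define d where "d = (\<lambda>i\<in>{1..r}. n i div p ^ multiplicity p (n i))"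
    have nd: "n i = d i * p ^ multiplicity p (n i)" if "i \<in> {1..r}" for i
      using that by (simp add: d_def multiplicity_dvd)
    have pd: "\<not> p dvd d i" if "i \<in> {1..r}" for i
      using that multiplicity_decompose[of "n i" p] tuples_gt_0[OF n that] p by (simp add: d_def)
    have d: "d \<in> tdivisors r n"
      using nd by (intro tdivisorsI) (simp add: d_def, metis dvd_triv_left)
    have dS: "d \<in> smooth r S"
      using smoothD[OF smooth_tdivisors[OF True d]] pd tdivisors_tuples[OF n d]
      by (intro smoothI) blast+
    have "tdiv r n d = (\<lambda>i\<in>{1..r}. p ^ multiplicity p (n i))"
    proof (rule extensionalityI[of _ "{1..r}"])
      fix i assume i: "i \<in> {1..r}"
      have "d i > 0" using tuples_gt_0[OF tdivisors_tuples[OF n d] i] .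
      then show "tdiv r n d i = (\<lambda>i\<in>{1..r}. p ^ multiplicity p (n i)) i"
        using i nd[OF i] by (simp add: tdiv_def) (metis nonzero_mult_div_cancel_left less_not_refl)
    qed simp_all
    then have qp: "tdiv r n d \<in> smooth r {p}"
      unfolding smooth_singleton[OF p] by (intro CollectI exI[of _ "\<lambda>i. multiplicity p (n i)"]) simp
    have uniq: "d' = d" if d': "d' \<in> tdivisors r n" "d' \<in> smooth r S" "tdiv r n d' \<in> smooth r {p}" for d'
    proof (rule extensionalityI[of _ "{1..r}"])
      fix i assume i: "i \<in> {1..r}"
      have "d' i * tdiv r n d' i = n i" "d i * tdiv r n d i = n i"
        using tmult_tdiv[OF n d'(1)] tmult_tdiv[OF n d] i unfolding tmult_def
        by (metis (no_types, lifting) restrict_apply)+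
      then have eq: "d' i * tdiv r n d' i = d i * tdiv r n d i" by simp
      \<comment> \<open>In the equality of the two factorizations, each smooth part is coprime to
        the \<open>p\<close>-part of the other factorization, so the smooth parts divide each
        other.\<close>
      have "coprime (d i) (tdiv r n d' i)" "coprime (d' i) (tdiv r n d i)"
        using smooth_coprime[OF dS d'(3) _ i i] smooth_coprime[OF d'(2) qp _ i i] pS by auto
      then have "d' i dvd d i" "d i dvd d' i"
        using eq by (metis coprime_dvd_mult_left_iff dvd_triv_left)+
      then show "d' i = d i" by (rule dvd_antisym)
    qed (use d d'(1) tdivisors_extensional in auto)
    have "fds_mult r (fds_smooth r S F) (fds_smooth r {p} F) n =
        fds_smooth r S F d * fds_smooth r {p} F (tdiv r n d)"
      using uniq by (intro fds_mult_single n d) (auto simp: fds_smooth_def)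
    also have "\<dots> = F d * F (tdiv r n d)"
      using dS qp by (simp add: fds_smooth_def)
    also have "\<dots> = F (tmult r d (tdiv r n d))"
      using F smooth_tuples[OF dS] smooth_tuples[OF qp] smooth_coprime[OF dS qp] pS
      unfolding tmultiplicative_def by auto
    finally show ?thesis using True tmult_tdiv[OF n d] by (simp add: fds_smooth_def)
  next
    case False
    have "fds_mult r (fds_smooth r S F) (fds_smooth r {p} F) n = 0"
    proof (cases "n \<in> tuples r")
      case n: True
      have "fds_smooth r S F d * fds_smooth r {p} F (tdiv r n d) = 0" if "d \<in> tdivisors r n" for d
        using False smooth_tmult[of d r S "tdiv r n d" "{p}"] tmult_tdiv[OF n that]
        by (auto simp: fds_smooth_def)
      then show ?thesis unfolding fds_mult_eq[OF n] by (intro sum.neutral) blast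
    qed (simp add: fds_mult_outside)
    then show ?thesis using False by (simp add: fds_smooth_def)
  qed
qed

lemma fds_smooth_empty:
  assumes "tmultiplicative r F"
  shows "fds_smooth r {} F = fds_one r"
proof -
  have "n = tone r" if n: "n \<in> smooth r {}" for n
  proof (rule extensionalityI[of _ "{1..r}"])
    fix i assume "i \<in> {1..r}"
    then show "n i = tone r i"
      using smoothD[OF n] prime_factor_nat[of "n i"] by (auto simp: tone_def)
  qed (use n tuples_extensional smooth_tuples in \<open>auto simp: tone_def\<close>)
  moreover have "tone r \<in> smooth r {}"
    using tone_tuples[of r] by (auto simp: smooth_def) (auto simp: tone_def)
  moreover have "F (tone r) = 1"
    using assms by (simp add: tmultiplicative_def)
  ultimately have "fds_smooth r {} F n = fds_one r n" for n
    unfolding fds_smooth_def fds_one_eq by metis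
  then show ?thesis ..
qed

section \<open>The identity at a single prime\<close>

text \<open>The coefficients of the product of all one-variable series, as confirmed by
  \<open>fds_prod_D\<close>.\<close>

definition fds_all :: "nat \<Rightarrow> (nat \<Rightarrow> nat \<Rightarrow> complex) \<Rightarrow> fds" where
  "fds_all r f n = (if n \<in> tuples r then \<Prod>i\<in>{1..r}. f i (n i) else 0)"

definition tpower :: "nat \<Rightarrow> nat \<Rightarrow> (nat \<Rightarrow> nat) \<Rightarrow> nat \<Rightarrow> nat" where
  "tpower r p e = (\<lambda>i\<in>{1..r}. p ^ e i)"

lemma smooth_singleton_tpower: "prime p \<Longrightarrow> smooth r {p} = range (tpower r p)"
  by (auto simp: smooth_singleton tpower_def)

lemma tpower_eq_iff:
  assumes "prime p"
  shows "tpower r p e = tpower r p b \<longleftrightarrow> (\<forall>i\<in>{1..r}. e i = b i)"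
proof
  assume eq: "tpower r p e = tpower r p b"
  show "\<forall>i\<in>{1..r}. e i = b i"
  proof
    fix i assume "i \<in> {1..r}"
    then have "p ^ e i = p ^ b i" using fun_cong[OF eq, of i] by (simp add: tpower_def)
    then show "e i = b i" using prime_gt_1_nat[OF assms] by simp
  qed
qed (auto simp: tpower_def)

lemma tone_eq_tpower: "tone r = tpower r p (\<lambda>_. 0)"
  by (simp add: tone_def tpower_def)

lemma fds_monom_outside:
  assumes "prime p" "n \<notin> smooth r {p}"
  shows "fds_monom r (\<lambda>l. if l \<in> L then p ^ a l else 1) n = 0"
proof -
  have "restrict (\<lambda>l. if l \<in> L then p ^ a l else 1) {1..r} = tpower r p (\<lambda>l. if l \<in> L then a l else 0)"
    by (auto simp: tpower_def)
  then show ?thesis using assms unfolding fds_monom_def smooth_singleton_tpower[OF assms(1)] by auto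
qed

lemma fds_euler_factor_outside:
  assumes "prime p" "n \<notin> smooth r {p}"
  shows "fds_euler_factor r t g p n = 0"
proof -
  have "n \<noteq> tone r"
    using assms unfolding smooth_singleton_tpower[OF assms(1)] tone_eq_tpower[of r p] by auto
  then show ?thesis
    by (simp add: fds_euler_factor_def fds_one_eq fds_monom_outside[OF assms])
qed

text \<open>Since the exponents \<open>a l\<close> are positive on \<open>L\<close>, a monomial
  determines both \<open>L\<close> and \<open>a\<close>. Hence the multiple sum contributes at most
  one term at \<open>tpower r p e\<close>, namely with \<open>L\<close> the support of
  \<open>e\<close> and \<open>a\<close> the restriction of \<open>e\<close> to it.\<close>

lemma fds_euler_factor_tpower:
  assumes p: "prime p"
  shows "fds_euler_factor r t g p (tpower r p e) =
    (1 - of_nat (card {i\<in>{1..r}. e i > 0})) * (\<Prod>i\<in>{1..r}. (- 1) ^ e i * G g t i (e i) p)"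
proof -
  define A where "A = {i\<in>{1..r}. e i > 0}"
  define y where "y = (\<lambda>i a. (- 1) ^ a * G g t i a p)"
  define Y where "Y = (\<Prod>i\<in>A. y i (e i))"
  \<comment> \<open>Indices outside the support contribute \<open>y i 0 = 1\<close>, by
    \<open>G_0\<close>.\<close>
  have Y_eq: "(\<Prod>i\<in>{1..r}. y i (e i)) = Y"
    unfolding Y_def A_def by (rule prod.mono_neutral_right) (auto simp: y_def)
  have A: "A \<subseteq> {1..r}" "finite A" by (auto simp: A_def)
  have monom: "fds_monom r (\<lambda>l. if l \<in> L then p ^ a l else 1) (tpower r p e) =
      (if L = A \<and> a = restrict e A then 1 else 0)"
    if L: "L \<subseteq> {1..r}" and a: "a \<in> L \<rightarrow>\<^sub>E {1..t}" for L a
  proof -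
    have "restrict (\<lambda>l. if l \<in> L then p ^ a l else 1) {1..r} = tpower r p (\<lambda>l. if l \<in> L then a l else 0)"
      by (auto simp: tpower_def)
    then have "fds_monom r (\<lambda>l. if l \<in> L then p ^ a l else 1) (tpower r p e) =
        (if \<forall>i\<in>{1..r}. e i = (if i \<in> L then a i else 0) then 1 else 0)"
      using tpower_eq_iff[OF p] by (simp add: fds_monom_def)
    moreover have "(\<forall>i\<in>{1..r}. e i = (if i \<in> L then a i else 0)) \<longleftrightarrow> L = A \<and> a = restrict e A"
    proof
      assume e: "\<forall>i\<in>{1..r}. e i = (if i \<in> L then a i else 0)"
      have "a i > 0" if "i \<in> L" for i using PiE_mem[OF a that] by simp
      moreover have "e i = (if i \<in> L then a i else 0)" if "i \<in> {1..r}" for i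
        using e that by blast
      ultimately have "L = A" using L by (auto simp: A_def split: if_splits)
      moreover have "a = restrict e L"
        using e L a by (intro extensionalityI[of _ L]) (auto simp: PiE_def)
      ultimately show "L = A \<and> a = restrict e A" by simp
    next
      assume "L = A \<and> a = restrict e A"
      then show "\<forall>i\<in>{1..r}. e i = (if i \<in> L then a i else 0)" by (auto simp: A_def)
    qed
    ultimately show ?thesis by presburger
  qed
  have inner: "(\<Sum>a\<in>L \<rightarrow>\<^sub>E {1..t}. fds_monom r (\<lambda>l. if l \<in> L then p ^ a l else 1) (tpower r p e) *
      (\<Prod>l\<in>L. (- 1) ^ a l * G g t l (a l) p)) = (if L = A then Y else 0)" (is "?S L = _")
    if L: "L \<subseteq> {1..r}" for L
  proof -
    have fin: "finite (L \<rightarrow>\<^sub>E {1..t})"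
      using L by (intro finite_PiE) (auto intro: finite_subset)
    have "?S L = (\<Sum>a\<in>L \<rightarrow>\<^sub>E {1..t}. if a = restrict e A then (if L = A then Y else 0) else 0)"
    proof (intro sum.cong refl)
      fix a assume "a \<in> L \<rightarrow>\<^sub>E {1..t}"
      moreover have "(\<Prod>l\<in>A. (- 1) ^ restrict e A l * G g t l (restrict e A l) p) = Y"
        unfolding Y_def y_def by (intro prod.cong) auto
      ultimately show "fds_monom r (\<lambda>l. if l \<in> L then p ^ a l else 1) (tpower r p e) *
          (\<Prod>l\<in>L. (- 1) ^ a l * G g t l (a l) p) =
          (if a = restrict e A then (if L = A then Y else 0) else 0)"
        using monom[OF L] by auto
    qed
    also have "\<dots> = (if restrict e A \<in> L \<rightarrow>\<^sub>E {1..t} then (if L = A then Y else 0) else 0)"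
      using fin by (simp add: sum.delta)
    also have "\<dots> = (if L = A then Y else 0)"
    \<comment> \<open>If some exponent on \<open>A\<close> exceeds \<open>t\<close>, no admissible
      \<open>a\<close> matches \<open>e\<close>; but then \<open>G_eq_0\<close> makes
      \<open>Y\<close> vanish, so the formula survives.\<close>
    proof (cases "L = A \<and> restrict e A \<notin> L \<rightarrow>\<^sub>E {1..t}")
      case True
      then obtain i where "i \<in> A" "e i \<notin> {1..t}"
        using restrict_PiE_iff[of e A "\<lambda>_. {1..t}"] by blast
      then have "i \<in> A" "y i (e i) = 0"
        using G_eq_0[of t "e i" g i p] by (auto simp: A_def y_def not_le)
      then have "Y = 0" using A unfolding Y_def by (meson prod_zero)
      then show ?thesis by simp
    qed auto
    finally show ?thesis .
  qed
  have outer: "(\<Sum>L | L \<subseteq> {1..r} \<and> card L = i. ?S L) = (if card A = i then Y else 0)" for i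
  proof -
    have "(\<Sum>L | L \<subseteq> {1..r} \<and> card L = i. ?S L) =
        (\<Sum>L | L \<subseteq> {1..r} \<and> card L = i. if L = A then Y else 0)"
      using inner by (intro sum.cong) auto
    also have "\<dots> = (if card A = i then Y else 0)"
      using A by (subst sum.delta) auto
    finally show ?thesis .
  qed
  have card: "card A \<le> r" using card_mono[OF _ A(1)] by simp
  have "fds_euler_factor r t g p (tpower r p e) =
      fds_one r (tpower r p e) - (\<Sum>i=2..r. (of_nat i - 1) * (if card A = i then Y else 0))"
    unfolding fds_euler_factor_def outer ..
  also have "(\<Sum>i=2..r. (of_nat i - 1) * (if card A = i then Y else 0)) =
      (\<Sum>i=2..r. if card A = i then (of_nat (card A) - 1) * Y else 0)"
    by (intro sum.cong) auto
  also have "\<dots> = (if card A \<ge> 2 then (of_nat (card A) - 1) * Y else 0)"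
    using card by (subst sum.delta') auto
  also have "fds_one r (tpower r p e) = (if A = {} then 1 else 0)"
    using tpower_eq_iff[OF p, of r e "\<lambda>_. 0"]
    by (auto simp: fds_one_eq tone_eq_tpower[of r p] A_def)
  also have "(if A = {} then 1 else 0) - (if card A \<ge> 2 then (of_nat (card A) - 1) * Y else 0) =
      (1 - of_nat (card A)) * Y"
  proof -
    \<comment> \<open>Empty support leaves only the unit series; a singleton support is met by
      neither part, in accordance with \<open>1 - 1 = 0\<close>; larger supports are met by the sum
      alone.\<close>
    consider "A = {}" | "card A = 1" | "card A \<ge> 2" "A \<noteq> {}"
      using A(2) by (metis One_nat_def card_0_eq le_0_eq less_2_cases_iff not_le)
    then show ?thesis
      by cases (auto simp: Y_def algebra_simps)
  qed
  finally show ?thesis unfolding Y_eq[unfolded y_def] A_def .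
qed

section \<open>Convolution at tuples of prime powers\<close>

lemma tdivisors_tpower:
  assumes p: "prime p"
  shows "tdivisors r (tpower r p e) = tpower r p ` (\<Pi>\<^sub>E i\<in>{1..r}. {..e i})"
proof (intro set_eqI iffI)
  fix d assume d: "d \<in> tdivisors r (tpower r p e)"
  then have "\<forall>i\<in>{1..r}. \<exists>b\<le>e i. d i = p ^ b"
    using tdivisors_dvd[OF d] by (simp add: tpower_def divides_primepow_nat[OF p])
  then obtain b where b: "\<And>i. i \<in> {1..r} \<Longrightarrow> b i \<le> e i \<and> d i = p ^ b i" by metis
  have "d = tpower r p (restrict b {1..r})"
    using b tdivisors_extensional[OF d] by (intro extensionalityI[of _ "{1..r}"]) (auto simp: tpower_def)
  moreover have "restrict b {1..r} \<in> (\<Pi>\<^sub>E i\<in>{1..r}. {..e i})" using b by auto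
  ultimately show "d \<in> tpower r p ` (\<Pi>\<^sub>E i\<in>{1..r}. {..e i})" by blast
next
  fix d assume "d \<in> tpower r p ` (\<Pi>\<^sub>E i\<in>{1..r}. {..e i})"
  then obtain b where b: "d = tpower r p b" "b \<in> (\<Pi>\<^sub>E i\<in>{1..r}. {..e i})" by blast
  show "d \<in> tdivisors r (tpower r p e)"
  proof (rule tdivisorsI)
    fix i assume "i \<in> {1..r}"
    then show "d i dvd tpower r p e i"
      using PiE_mem[OF b(2)] by (simp add: b tpower_def le_imp_power_dvd)
  qed (simp add: b tpower_def)
qed

lemma inj_on_tpower:
  assumes p: "prime p"
  shows "inj_on (tpower r p) (\<Pi>\<^sub>E i\<in>{1..r}. B i)"
  using tpower_eq_iff[OF p] by (intro inj_onI PiE_ext) auto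

text \<open>
  Summing the number of indices with \<open>b\<^sub>j = e\<^sub>j\<close> instead of the size of the support lets every
  sum over \<open>b\<close> factor into sums over the single \<open>b\<^sub>i\<close>.
\<close>

lemma fds_mult_all_euler_factor_tpower:
  assumes p: "prime p"
    and inverse: "\<And>i k. i \<in> {1..r} \<Longrightarrow>
      (\<Sum>a\<le>k. f i (p ^ a) * ((- 1) ^ (k - a) * G g t i (k - a) p)) = (if k = 0 then 1 else 0)"
  shows "fds_mult r (fds_all r f) (fds_euler_factor r t g p) (tpower r p e) =
    (1 - of_nat r) * (\<Prod>i\<in>{1..r}. if e i = 0 then 1 else 0) +
    (\<Sum>j\<in>{1..r}. \<Prod>i\<in>{1..r}. if i = j then f j (p ^ e j) else if e i = 0 then 1 else 0)"
proof -
  define y where "y = (\<lambda>i a. (- 1) ^ a * G g t i a p)"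
  define B where "B = (\<Pi>\<^sub>E i\<in>{1..r}. {..e i})"
  define u where "u = (\<lambda>i a. f i (p ^ a) * y i (e i - a))"
  have tup: "tpower r p b \<in> tuples r" for b
    using smooth_tuples[of _ r "{p}"] smooth_singleton_tpower[OF p] by blast
  have y0: "y i 0 = 1" for i by (simp add: y_def)
  have inv: "(\<Sum>a\<le>e i. u i a) = (if e i = 0 then 1 else 0)" if "i \<in> {1..r}" for i
    using inverse[OF that] by (simp add: u_def y_def)
  have le: "b i \<le> e i" if "b \<in> B" "i \<in> {1..r}" for b i
    using PiE_mem[OF that[unfolded B_def]] by simp
  have quot: "tdiv r (tpower r p e) (tpower r p b) = tpower r p (\<lambda>i. e i - b i)" if "b \<in> B" for b
    using le[OF that] p by (auto simp: tdiv_def tpower_def power_diff prime_gt_0_nat intro!: restrict_ext)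
  \<comment> \<open>Because \<open>b\<close> is bounded by \<open>e\<close>, the support of
    \<open>e - b\<close> is the complement of the set where \<open>b\<close> and \<open>e\<close>
    agree. This trades the size of the support for a sum of indicators.\<close>
  have count: "1 - of_nat (card {i\<in>{1..r}. e i - b i > 0}) =
      (1 - of_nat r :: complex) + (\<Sum>j\<in>{1..r}. if b j = e j then 1 else 0)" if "b \<in> B" for b
  proof -
    have "(\<Sum>j\<in>{1..r}. if b j = e j then 1 else 0) = (of_nat (card {j\<in>{1..r}. b j = e j}) :: complex)"
      by (simp flip: sum.inter_filter)
    moreover have "{i\<in>{1..r}. e i - b i > 0} = {1..r} - {j\<in>{1..r}. b j = e j}"
      using le[OF that] by fastforce
    moreover have "card {j\<in>{1..r}. b j = e j} \<le> r"
      using card_mono[of "{1..r}" "{j\<in>{1..r}. b j = e j}"]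
      by (metis (lifting) card_atLeastAtMost diff_Suc_1 finite_atLeastAtMost mem_Collect_eq subsetI One_nat_def)
    ultimately show ?thesis
      by (simp only: card_Diff_subset finite_Collect_conjI finite_atLeastAtMost
          Collect_mem_eq finite_subset[OF Collect_restrict] Collect_restrict card_atLeastAtMost of_nat_diff) simp
  qed
  have "fds_mult r (fds_all r f) (fds_euler_factor r t g p) (tpower r p e) =
      (\<Sum>b\<in>B. fds_all r f (tpower r p b) *
        fds_euler_factor r t g p (tdiv r (tpower r p e) (tpower r p b)))"
    unfolding fds_mult_eq[OF tup] tdivisors_tpower[OF p] B_def
    by (simp add: sum.reindex inj_on_tpower[OF p])
  also have "\<dots> = (\<Sum>b\<in>B. ((1 - of_nat r) + (\<Sum>j\<in>{1..r}. if b j = e j then 1 else 0)) *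
      (\<Prod>i\<in>{1..r}. u i (b i)))"
  proof (intro sum.cong refl)
    fix b assume b: "b \<in> B"
    have "fds_all r f (tpower r p b) = (\<Prod>i\<in>{1..r}. f i (p ^ b i))"
      using tup by (simp add: fds_all_def) (simp add: tpower_def)
    then show "fds_all r f (tpower r p b) * fds_euler_factor r t g p (tdiv r (tpower r p e) (tpower r p b)) =
        ((1 - of_nat r) + (\<Sum>j\<in>{1..r}. if b j = e j then 1 else 0)) * (\<Prod>i\<in>{1..r}. u i (b i))"
      unfolding quot[OF b] fds_euler_factor_tpower[OF p] count[OF b] u_def y_def prod.distrib
      by (simp only: mult_ac)
  qed
  also have "\<dots> = (1 - of_nat r) * (\<Sum>b\<in>B. \<Prod>i\<in>{1..r}. u i (b i)) +
      (\<Sum>j\<in>{1..r}. \<Sum>b\<in>B. (if b j = e j then 1 else 0) * (\<Prod>i\<in>{1..r}. u i (b i)))"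
    unfolding distrib_right sum.distrib sum_distrib_left sum_distrib_right
    by (subst sum.swap) (rule refl)
  also have "(\<Sum>b\<in>B. \<Prod>i\<in>{1..r}. u i (b i)) = (\<Prod>i\<in>{1..r}. if e i = 0 then 1 else 0)"
  proof -
    have "(\<Sum>b\<in>B. \<Prod>i\<in>{1..r}. u i (b i)) = (\<Prod>i\<in>{1..r}. \<Sum>a\<le>e i. u i a)"
      unfolding B_def by (subst prod_sum_PiE) auto
    also have "\<dots> = (\<Prod>i\<in>{1..r}. if e i = 0 then 1 else 0)"
      by (intro prod.cong refl inv)
    finally show ?thesis .
  qed
  also have "(\<Sum>j\<in>{1..r}. \<Sum>b\<in>B. (if b j = e j then 1 else 0) * (\<Prod>i\<in>{1..r}. u i (b i))) =
      (\<Sum>j\<in>{1..r}. \<Prod>i\<in>{1..r}. if i = j then f j (p ^ e j) else if e i = 0 then 1 else 0)"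
  proof (intro sum.cong refl)
    fix j assume j: "j \<in> {1..r}"
    \<comment> \<open>The indicator of \<open>b j = e j\<close> is moved into the
      \<open>j\<close>-th factor, so that the sum over \<open>b\<close> still factors.\<close>
    define v where "v = (\<lambda>i a. if i = j then (if a = e j then u j a else 0) else u i a)"
    have "(if b j = e j then 1 else 0) * (\<Prod>i\<in>{1..r}. u i (b i)) = (\<Prod>i\<in>{1..r}. v i (b i))" for b
    proof (cases "b j = e j")
      case True
      then show ?thesis by (auto simp: v_def intro!: prod.cong)
    next
      case False
      then have "(\<Prod>i\<in>{1..r}. v i (b i)) = 0"
        using j by (intro prod_zero bexI[of _ j]) (auto simp: v_def)
      then show ?thesis using False by simp
    qed
    then have "(\<Sum>b\<in>B. (if b j = e j then 1 else 0) * (\<Prod>i\<in>{1..r}. u i (b i))) =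
        (\<Prod>i\<in>{1..r}. \<Sum>a\<le>e i. v i a)"
      unfolding B_def by (subst prod_sum_PiE) auto
    also have "\<dots> = (\<Prod>i\<in>{1..r}. if i = j then f j (p ^ e j) else if e i = 0 then 1 else 0)"
    proof (intro prod.cong refl)
      fix i assume "i \<in> {1..r}"
      \<comment> \<open>For \<open>i = j\<close> only \<open>a = e j\<close> survives, with cofactor
        \<open>y j 0 = 1\<close>; for the other indices the full inverse relation applies.\<close>
      then show "(\<Sum>a\<le>e i. v i a) = (if i = j then f j (p ^ e j) else if e i = 0 then 1 else 0)"
        using inv by (simp add: v_def u_def y0)
    qed
    finally show "(\<Sum>b\<in>B. (if b j = e j then 1 else 0) * (\<Prod>i\<in>{1..r}. u i (b i))) =
        (\<Prod>i\<in>{1..r}. if i = j then f j (p ^ e j) else if e i = 0 then 1 else 0)" .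
  qed
  finally show ?thesis .
qed

text \<open>A tuple of powers of \<open>p\<close> is pairwise coprime exactly when its support
  \<open>A\<close> has at most one element. The first product indicates \<open>A = {}\<close> and
  the \<open>j\<close>-th product in the sum indicates \<open>A \<subseteq> {j}\<close>; for empty
  support, the \<open>r\<close> summands equal to 1 turn \<open>1 - r\<close> into 1.\<close>

lemma fds_coprime_tpower:
  assumes p: "prime p" and one: "\<And>i. i \<in> {1..r} \<Longrightarrow> f i 1 = 1"
  shows "fds_coprime r f (tpower r p e) =
    (1 - of_nat r) * (\<Prod>i\<in>{1..r}. if e i = 0 then 1 else 0) +
    (\<Sum>j\<in>{1..r}. \<Prod>i\<in>{1..r}. if i = j then f j (p ^ e j) else if e i = 0 then 1 else 0)"
proof -
  define A where "A = {i\<in>{1..r}. e i > 0}"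
  have tup: "tpower r p e \<in> tuples r"
    using smooth_tuples[of _ r "{p}"] smooth_singleton_tpower[OF p] by blast
  have cop: "coprime (tpower r p e i) (tpower r p e j) \<longleftrightarrow> e i = 0 \<or> e j = 0"
    if "i \<in> {1..r}" "j \<in> {1..r}" for i j
    using that not_prime_1 p by (auto simp: tpower_def One_nat_def)
  have cop_iff: "tpower r p e \<in> coprime_tuples r \<longleftrightarrow> (\<forall>i\<in>A. \<forall>j\<in>A. i = j)"
  proof -
    have "tpower r p e \<in> coprime_tuples r \<longleftrightarrow> (\<forall>i\<in>{1..r}. \<forall>j\<in>{1..r}. i \<noteq> j \<longrightarrow> e i = 0 \<or> e j = 0)"
      using tup cop unfolding coprime_tuples_def by simp
    then show ?thesis unfolding A_def by (metis (no_types, lifting) gr0I less_not_refl mem_Collect_eq)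
  qed
  have prod0: "(\<Prod>i\<in>{1..r}. if e i = 0 then 1 else 0) = (if A = {} then 1 else (0::complex))"
    by (cases "A = {}") (auto simp: A_def intro!: prod_zero prod.neutral)
  have prodj: "(\<Prod>i\<in>{1..r}. if i = j then f j (p ^ e j) else if e i = 0 then 1 else 0) =
      (if A \<subseteq> {j} then f j (p ^ e j) else 0)" if j: "j \<in> {1..r}" for j
  proof (cases "A \<subseteq> {j}")
    case True
    then have "(\<Prod>i\<in>{1..r}. if i = j then f j (p ^ e j) else if e i = 0 then 1 else 0) =
        (\<Prod>i\<in>{1..r}. if i = j then f j (p ^ e j) else 1)"
      by (intro prod.cong) (auto simp: A_def)
    then show ?thesis using True j by (simp add: prod.delta)
  next
    case False
    then obtain k where "k \<in> {1..r}" "e k > 0" "k \<noteq> j" by (auto simp: A_def)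
    then show ?thesis using False by (auto intro!: prod_zero bexI[of _ k])
  qed
  have "fds_coprime r f (tpower r p e) =
      (1 - of_nat r) * (if A = {} then 1 else 0) + (\<Sum>j\<in>{1..r}. if A \<subseteq> {j} then f j (p ^ e j) else 0)"
  proof -
    consider "A = {}" | k where "A = {k}" | i j where "i \<in> A" "j \<in> A" "i \<noteq> j"
      by blast
    then show ?thesis
    proof cases
      case 1
      then have e: "e i = 0" if "i \<in> {1..r}" for i using that by (auto simp: A_def)
      have "(\<Prod>i\<in>{1..r}. f i (tpower r p e i)) = 1"
        using e one by (intro prod.neutral) (simp add: tpower_def)
      moreover have "(\<Sum>j\<in>{1..r}. f j (p ^ e j)) = of_nat r"
        using e one by simp
      ultimately show ?thesis using 1 cop_iff by (simp add: fds_coprime_def)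
    next
      case 2
      then have "k \<in> A" by simp
      then have "k \<in> {1..r}" by (simp add: A_def)
      have e: "e i = 0" if "i \<in> {1..r}" "i \<noteq> k" for i
      proof -
        have "i \<notin> A" using 2 that by simp
        then show ?thesis using that by (simp add: A_def)
      qed
      have "(\<Prod>i\<in>{1..r}. f i (tpower r p e i)) = (\<Prod>i\<in>{1..r}. if i = k then f k (p ^ e k) else 1)"
        using e one by (intro prod.cong) (auto simp: tpower_def)
      also have "\<dots> = f k (p ^ e k)"
        using \<open>k \<in> {1..r}\<close> by (simp add: prod.delta)
      also have "\<dots> = (\<Sum>j\<in>{1..r}. if k = j then f j (p ^ e j) else 0)"
        using \<open>k \<in> {1..r}\<close> by (simp add: sum.delta')
      finally show ?thesis using 2 cop_iff by (simp add: fds_coprime_def)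
    next
      case 3
      then have "A \<noteq> {}" "\<not> A \<subseteq> {k}" for k by auto
      then show ?thesis using 3 cop_iff by (auto simp: fds_coprime_def)
    qed
  qed
  also have "(\<Sum>j\<in>{1..r}. if A \<subseteq> {j} then f j (p ^ e j) else 0) =
      (\<Sum>j\<in>{1..r}. \<Prod>i\<in>{1..r}. if i = j then f j (p ^ e j) else if e i = 0 then 1 else 0)"
    using prodj by (intro sum.cong) auto
  finally show ?thesis unfolding prod0 .
qed

text \<open>At tuples of powers of \<open>p\<close> both sides have the common value computed above;
  elsewhere both vanish, since products of \<open>p\<close>-smooth tuples are
  \<open>p\<close>-smooth.\<close>

lemma fds_coprime_local:
  assumes p: "prime p" and one: "\<And>i. i \<in> {1..r} \<Longrightarrow> f i 1 = 1"
    and inverse: "\<And>i k. i \<in> {1..r} \<Longrightarrow>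
      (\<Sum>a\<le>k. f i (p ^ a) * ((- 1) ^ (k - a) * G g t i (k - a) p)) = (if k = 0 then 1 else 0)"
  shows "fds_smooth r {p} (fds_coprime r f) =
    fds_mult r (fds_smooth r {p} (fds_all r f)) (fds_euler_factor r t g p)"
proof
  fix n
  show "fds_smooth r {p} (fds_coprime r f) n =
    fds_mult r (fds_smooth r {p} (fds_all r f)) (fds_euler_factor r t g p) n"
  proof (cases "n \<in> smooth r {p}")
    case True
    then obtain e where e: "n = tpower r p e" unfolding smooth_singleton_tpower[OF p] by blast
    have n: "n \<in> tuples r" using True by (rule smooth_tuples)
    \<comment> \<open>Divisors of a smooth tuple are smooth, so the truncation does not affect the
      coefficient at \<open>n\<close>.\<close>
    have "fds_mult r (fds_smooth r {p} (fds_all r f)) (fds_euler_factor r t g p) n =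
        fds_mult r (fds_all r f) (fds_euler_factor r t g p) n"
      unfolding fds_mult_eq[OF n] using smooth_tdivisors[OF True]
      by (intro sum.cong) (auto simp: fds_smooth_def)
    also have "\<dots> = fds_coprime r f n"
      unfolding e using assms by (simp only: fds_mult_all_euler_factor_tpower fds_coprime_tpower)
    finally show ?thesis using True by (simp add: fds_smooth_def)
  next
    case False
    have "fds_mult r (fds_smooth r {p} (fds_all r f)) (fds_euler_factor r t g p) n = 0"
    proof (cases "n \<in> tuples r")
      case n: True
      have "fds_smooth r {p} (fds_all r f) d * fds_euler_factor r t g p (tdiv r n d) = 0"
        if "d \<in> tdivisors r n" for d
        using False smooth_tmult[of d r "{p}" "tdiv r n d" "{p}"] tmult_tdiv[OF n that]
          fds_euler_factor_outside[OF p, of "tdiv r n d" r t g]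
        by (auto simp: fds_smooth_def)
      then show ?thesis unfolding fds_mult_eq[OF n] by (intro sum.neutral) blast
    qed (simp add: fds_mult_outside)
    then show ?thesis using False by (simp add: fds_smooth_def)
  qed
qed

section \<open>The formal identity\<close>

lemma fds_mult_one_one: "fds_mult r (fds_one r) (fds_one r) = fds_one r"
proof
  fix n
  show "fds_mult r (fds_one r) (fds_one r) n = fds_one r n"
    by (cases "n \<in> tuples r") (auto simp: fds_mult_one_left fds_mult_outside fds_one_eq)
qed

section \<open>Multiplicativity of the coefficient functions and the identity over finitely many
  primes\<close>

lemma tmultiplicative_fds_all:
  assumes "\<And>i. i \<in> {1..r} \<Longrightarrow> multiplicative (f i)"
  shows "tmultiplicative r (fds_all r f)"
  unfolding tmultiplicative_def
proof (intro conjI ballI impI)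
  show "fds_all r f (tone r) = 1"
    using assms by (simp add: fds_all_def) (auto simp: tone_def multiplicative_def intro!: prod.neutral)
next
  fix m k assume m: "m \<in> tuples r" and k: "k \<in> tuples r"
    and cop: "\<forall>i\<in>{1..r}. \<forall>j\<in>{1..r}. coprime (m i) (k j)"
  have "f i (tmult r m k i) = f i (m i) * f i (k i)" if "i \<in> {1..r}" for i
    using assms[OF that] tuples_gt_0[OF m that] tuples_gt_0[OF k that] cop that
    by (simp add: multiplicative_def tmult_def Suc_le_eq One_nat_def)
  then show "fds_all r f (tmult r m k) = fds_all r f m * fds_all r f k"
    using m k tmult_tuples[OF m k] by (simp add: fds_all_def flip: prod.distrib)
qed

lemma fds_coprime_eq_fds_all:
  "fds_coprime r f n = (if n \<in> coprime_tuples r then fds_all r f n else 0)"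
  by (auto simp: fds_coprime_def fds_all_def coprime_tuples_def)

text \<open>Since the entries of \<open>m\<close> are coprime to those of \<open>k\<close>, the
  product tuple is pairwise coprime exactly when both factors are.\<close>

lemma tmultiplicative_fds_coprime:
  assumes "\<And>i. i \<in> {1..r} \<Longrightarrow> multiplicative (f i)"
  shows "tmultiplicative r (fds_coprime r f)"
proof -
  have all: "tmultiplicative r (fds_all r f)"
    using assms by (rule tmultiplicative_fds_all)
  have "tone r \<in> coprime_tuples r"
    using tone_tuples[of r] by (simp add: coprime_tuples_def) (simp add: tone_def)
  moreover have "tmult r m k \<in> coprime_tuples r \<longleftrightarrow> m \<in> coprime_tuples r \<and> k \<in> coprime_tuples r"
    if m: "m \<in> tuples r" and k: "k \<in> tuples r"
      and cop: "\<forall>i\<in>{1..r}. \<forall>j\<in>{1..r}. coprime (m i) (k j)" for m k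
  proof -
    have "coprime (m i * k i) (m j * k j) \<longleftrightarrow> coprime (m i) (m j) \<and> coprime (k i) (k j)"
      if "i \<in> {1..r}" "j \<in> {1..r}" for i j
      using cop that by (auto simp: coprime_commute)
    then show ?thesis
      using m k tmult_tuples[OF m k] unfolding coprime_tuples_def by (auto simp: tmult_def)
  qed
  ultimately show ?thesis
    using all unfolding tmultiplicative_def fds_coprime_eq_fds_all by auto
qed

text \<open>The common source of the formal and the analytic identity. Adding a prime splits both
  smooth series by \<open>fds_smooth_insert\<close>, and the local identity supplies the new Euler
  factor.\<close>

lemma fds_coprime_smooth:
  assumes mult: "\<And>i. i \<in> {1..r} \<Longrightarrow> multiplicative (f i)"
    and inverse: "\<And>i p k. i \<in> {1..r} \<Longrightarrow> prime p \<Longrightarrow>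
      (\<Sum>a\<le>k. f i (p ^ a) * ((- 1) ^ (k - a) * G g t i (k - a) p)) = (if k = 0 then 1 else 0)"
    and S: "finite S" "\<And>p. p \<in> S \<Longrightarrow> prime p"
  shows "fds_smooth r S (fds_coprime r f) =
    fds_mult r (fds_smooth r S (fds_all r f)) (fds_prod r (fds_euler_factor r t g) S)"
  using S
proof (induction rule: finite_induct)
  case empty
  then show ?case
    using fds_smooth_empty[OF tmultiplicative_fds_all[OF mult]]
      fds_smooth_empty[OF tmultiplicative_fds_coprime[OF mult]]
    by (simp add: fds_prod_empty fds_mult_one_one)
next
  case (insert p S)
  have p: "prime p" using insert by simp
  have one: "f i 1 = 1" if "i \<in> {1..r}" for i
    using mult[OF that] by (simp add: multiplicative_def)
  have "fds_smooth r (insert p S) (fds_coprime r f) =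
      fds_mult r (fds_smooth r S (fds_coprime r f)) (fds_smooth r {p} (fds_coprime r f))"
    using mult p insert.hyps by (intro fds_smooth_insert tmultiplicative_fds_coprime)
  also have "fds_smooth r {p} (fds_coprime r f) =
      fds_mult r (fds_smooth r {p} (fds_all r f)) (fds_euler_factor r t g p)"
    using p one inverse by (intro fds_coprime_local) auto
  also have "fds_smooth r S (fds_coprime r f) =
      fds_mult r (fds_smooth r S (fds_all r f)) (fds_prod r (fds_euler_factor r t g) S)"
    using insert by simp
  also have "fds_mult r (fds_mult r (fds_smooth r S (fds_all r f)) (fds_prod r (fds_euler_factor r t g) S))
      (fds_mult r (fds_smooth r {p} (fds_all r f)) (fds_euler_factor r t g p)) =
      fds_mult r (fds_mult r (fds_smooth r S (fds_all r f)) (fds_smooth r {p} (fds_all r f)))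
       (fds_mult r (fds_prod r (fds_euler_factor r t g) S) (fds_euler_factor r t g p))"
    by (rule fds_mult_mult_swap)
  also have "fds_mult r (fds_smooth r S (fds_all r f)) (fds_smooth r {p} (fds_all r f)) =
      fds_smooth r (insert p S) (fds_all r f)"
    using mult p insert.hyps by (intro fds_smooth_insert[symmetric] tmultiplicative_fds_all)
  also have "fds_mult r (fds_prod r (fds_euler_factor r t g) S) (fds_euler_factor r t g p) =
      fds_prod r (fds_euler_factor r t g) (insert p S)"
    using insert.hyps by (simp add: fds_prod_insert fds_mult_commute)
  finally show ?case .
qed

section \<open>Coefficientwise convergence of the Euler product\<close>

lemma fds_euler_factor_tone:
  assumes "prime p"
  shows "fds_euler_factor r t g p (tone r) = 1"
  by (simp add: fds_euler_factor_tpower[OF assms] tone_eq_tpower[of r p])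

text \<open>The Euler factor of a prime outside \<open>S\<close> acts like the unit at an
  \<open>S\<close>-smooth tuple: among the divisors of the tuple, its support contains only
  \<open>tone r\<close>, with coefficient 1.\<close>

lemma fds_prod_euler_factor_stable:
  assumes "finite S'" "S \<subseteq> S'" "\<And>p. p \<in> S' \<Longrightarrow> prime p" "n \<in> smooth r S"
  shows "fds_prod r (fds_euler_factor r t g) S' n = fds_prod r (fds_euler_factor r t g) S n"
proof -
  have n: "n \<in> tuples r" using assms(4) by (rule smooth_tuples)
  have "fds_prod r (fds_euler_factor r t g) (S \<union> T) n = fds_prod r (fds_euler_factor r t g) S n"
    if "finite T" "T \<subseteq> S' - S" for T
    using that
  proof (induction rule: finite_induct)
    case (insert p T)
    have p: "prime p" "p \<notin> S \<union> T" using insert assms by auto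
    have fin: "finite (S \<union> T)" using assms insert.hyps by (auto intro: finite_subset)
    have zero: "fds_euler_factor r t g p d = 0" if d: "d \<in> tdivisors r n" "d \<noteq> tone r" for d
    proof (rule fds_euler_factor_outside[OF p(1)])
      show "d \<notin> smooth r {p}"
      proof
        assume dp: "d \<in> smooth r {p}"
        have dS: "d \<in> smooth r S" using assms(4) d(1) by (rule smooth_tdivisors)
        have "d = tone r"
        proof (rule extensionalityI[of _ "{1..r}"])
          fix i assume i: "i \<in> {1..r}"
          \<comment> \<open>An entry that is both a product of primes in \<open>S\<close> and a
            power of \<open>p\<close> is coprime to itself, hence 1.\<close>
          have "coprime (d i) (d i)"
            using smooth_coprime[OF dp dS _ i i] p by auto
          then show "d i = tone r i" using i by (simp add: tone_def)
        qed (use d tdivisors_extensional in \<open>auto simp: tone_def\<close>)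
        then show False using d by simp
      qed
    qed
    have "fds_prod r (fds_euler_factor r t g) (S \<union> insert p T) n =
        fds_mult r (fds_euler_factor r t g p) (fds_prod r (fds_euler_factor r t g) (S \<union> T)) n"
      using fds_prod_insert[OF fin p(2), of r "fds_euler_factor r t g"] by simp
    also have "\<dots> = fds_euler_factor r t g p (tone r) *
        fds_prod r (fds_euler_factor r t g) (S \<union> T) (tdiv r n (tone r))"
      using zero by (intro fds_mult_single n tone_tdivisors) simp
    also have "\<dots> = fds_prod r (fds_euler_factor r t g) (S \<union> T) n"
      by (simp add: fds_euler_factor_tone[OF p(1)] tdiv_tone[OF n])
    finally show ?case using insert by simp
  qed simp
  from this[of "S' - S"] assms(1,2) show ?thesis by (simp add: Un_absorb1)
qed

lemma fds_prod_outside: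
  assumes "finite S" "n \<notin> tuples r"
  shows "fds_prod r F S n = 0"
  using assms
proof (induction rule: finite_induct)
  case empty
  then show ?case by (auto simp: fds_prod_empty fds_one_eq)
next
  case (insert p S)
  then show ?case by (simp add: fds_prod_insert fds_mult_outside)
qed

text \<open>Stated for a partial set \<open>A\<close> of variables to permit induction. The product
  may run over all of \<open>{1..r}\<close>, because entries outside \<open>A\<close> are 1 and
  \<open>f i 1 = 1\<close>.\<close>

lemma fds_D_prod:
  assumes "finite A" "A \<subseteq> {1..r}" "\<And>i. i \<in> {1..r} \<Longrightarrow> f i 1 = 1"
  shows "fds_prod r (\<lambda>i. fds_D r i (f i)) A n =
    (if n \<in> tuples r \<and> (\<forall>j\<in>{1..r} - A. n j = 1) then \<Prod>i\<in>{1..r}. f i (n i) else 0)"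
  using assms(1,2)
proof (induction arbitrary: n rule: finite_induct)
  case empty
  have "n = tone r \<longleftrightarrow> n \<in> tuples r \<and> (\<forall>j\<in>{1..r}. n j = 1)"
  proof
    assume "n \<in> tuples r \<and> (\<forall>j\<in>{1..r}. n j = 1)"
    then show "n = tone r"
      using tuples_extensional[of n r] tuples_extensional[OF tone_tuples[of r]]
      by (intro extensionalityI[of _ "{1..r}"]) (simp_all add: tone_def)
  qed (use tone_tuples[of r] in \<open>simp add: tone_def\<close>)
  moreover have "(\<Prod>i\<in>{1..r}. f i (tone r i)) = 1"
    using assms(3) by (intro prod.neutral) (simp add: tone_def)
  ultimately show ?case by (auto simp: fds_prod_empty fds_one_eq)
next
  case (insert k A)
  have k: "k \<in> {1..r}" using insert by simp
  show ?case
  proof (cases "n \<in> tuples r")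
    case n: True
    \<comment> \<open>The new factor \<open>fds_D\<close> forces trivial entries away from
      \<open>k\<close>, and the remaining product forces a trivial entry at \<open>k\<close> in the
      quotient. Only this divisor meets both conditions.\<close>
    define d where "d = (\<lambda>i\<in>{1..r}. if i = k then n k else 1)"
    have d: "d \<in> tdivisors r n" by (rule tdivisorsI) (auto simp: d_def)
    have zero: "fds_D r k (f k) d' * fds_prod r (\<lambda>i. fds_D r i (f i)) A (tdiv r n d') = 0"
      if d': "d' \<in> tdivisors r n" "d' \<noteq> d" for d'
    proof (rule ccontr)
      assume "\<not> ?thesis"
      then have "fds_D r k (f k) d' \<noteq> 0" "fds_prod r (\<lambda>i. fds_D r i (f i)) A (tdiv r n d') \<noteq> 0"
        by auto
      moreover have "k \<in> {1..r} - A" "A \<subseteq> {1..r}" using insert k by auto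
      ultimately have 1: "\<forall>j\<in>{1..r}. j \<noteq> k \<longrightarrow> d' j = 1" and 2: "tdiv r n d' k = 1"
        unfolding insert.IH[OF \<open>A \<subseteq> {1..r}\<close>] fds_D_def[of r k] by (simp_all split: if_splits)
      have "n k = d' k"
        using arg_cong[OF tmult_tdiv[OF n d'(1)], of "\<lambda>x. x k"] 2 k by (simp add: tmult_def)
      then have "d' = d"
        using 1 tdivisors_extensional[OF d'(1)]
        by (intro extensionalityI[of _ "{1..r}"]) (auto simp: d_def)
      then show False using d' by simp
    qed
    have q: "tdiv r n d = (\<lambda>i\<in>{1..r}. if i = k then 1 else n i)"
      using tuples_gt_0[OF n k] by (auto simp: tdiv_def d_def intro!: restrict_ext)
    have dt: "d \<in> tuples r" "tdiv r n d \<in> tuples r"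
      using n d tdivisors_tuples tdiv_tuples by auto
    have "fds_prod r (\<lambda>i. fds_D r i (f i)) (insert k A) n =
        fds_D r k (f k) d * fds_prod r (\<lambda>i. fds_D r i (f i)) A (tdiv r n d)"
      unfolding fds_prod_insert[OF insert.hyps] using zero by (intro fds_mult_single n d)
    also have "fds_D r k (f k) d = f k (n k)"
      using dt k by (auto simp: fds_D_def) (auto simp: d_def)
    also have "fds_prod r (\<lambda>i. fds_D r i (f i)) A (tdiv r n d) =
        (if \<forall>j\<in>{1..r} - insert k A. n j = 1 then \<Prod>i\<in>{1..r}. f i (tdiv r n d i) else 0)"
      using dt insert k by (auto simp: q)
    also have "(\<Prod>i\<in>{1..r}. f i (tdiv r n d i)) = (\<Prod>i\<in>{1..r} - {k}. f i (n i))"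
      using k assms(3) by (subst prod.remove[of _ k]) (auto simp: q intro!: prod.cong)
    finally show ?thesis
      using n k prod.remove[of "{1..r}" k "\<lambda>i. f i (n i)"] by auto
  qed (use insert in \<open>simp add: fds_prod_outside\<close>)
qed

lemma fds_prod_D:
  assumes "\<And>i. i \<in> {1..r} \<Longrightarrow> f i 1 = 1"
  shows "fds_prod r (\<lambda>i. fds_D r i (f i)) {1..r} = fds_all r f"
  using fds_D_prod[of "{1..r}" r f] assms by (auto simp: fun_eq_iff fds_all_def)

lemma formal_identity:
  assumes mult: "\<And>i. i \<in> {1..r} \<Longrightarrow> multiplicative (f i)"
    and inverse: "\<And>i p k. i \<in> {1..r} \<Longrightarrow> prime p \<Longrightarrow>
      (\<Sum>a\<le>k. f i (p ^ a) * ((- 1) ^ (k - a) * G g t i (k - a) p)) = (if k = 0 then 1 else 0)"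
  shows "\<exists>\<Delta>. fds_has_prod r (fds_euler_factor r t g) {p. prime p} \<Delta> \<and>
    fds_coprime r f = fds_mult r (fds_prod r (\<lambda>i. fds_D r i (f i)) {1..r}) \<Delta>"
proof (intro exI conjI)
  \<comment> \<open>By stability, the primes dividing some entry of \<open>n\<close> already
    determine the coefficient of the infinite product at \<open>n\<close>; this gives the witness
    \<Delta>.\<close>
  define S where "S = (\<lambda>n::nat \<Rightarrow> nat. {q. prime q \<and> (\<exists>i\<in>{1..r}. q dvd n i)})"
  define \<Delta> where "\<Delta> = (\<lambda>n. if n \<in> tuples r then fds_prod r (fds_euler_factor r t g) (S n) n else 0)"
  have fin: "finite (S n)" if n: "n \<in> tuples r" for n
  proof -
    have "S n = (\<Union>i\<in>{1..r}. {q. prime q \<and> q dvd n i})" by (auto simp: S_def)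
    then show ?thesis using tuples_gt_0[OF n] by auto
  qed
  have prime: "prime q" if "q \<in> S n" for q n using that by (simp add: S_def)
  have nS: "n \<in> smooth r (S n)" if "n \<in> tuples r" for n
    using that by (intro smoothI) (auto simp: S_def)
  have \<Delta>_eq: "fds_prod r (fds_euler_factor r t g) T n = \<Delta> n"
    if "finite T" "n \<in> smooth r T" "\<And>q. q \<in> T \<Longrightarrow> prime q" for T n
  proof -
    have "S n \<subseteq> T" using smoothD[OF that(2)] by (auto simp: S_def)
    then show ?thesis
      using fds_prod_euler_factor_stable[OF that(1), of "S n" n r t g] that nS smooth_tuples
      by (auto simp: \<Delta>_def)
  qed
  show "fds_has_prod r (fds_euler_factor r t g) {p. prime p} \<Delta>"
    unfolding fds_has_prod_def
  proof
    fix n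
    show "\<forall>\<^sub>F T in finite_subsets_at_top {p. prime p}. fds_prod r (fds_euler_factor r t g) T n = \<Delta> n"
    proof (cases "n \<in> tuples r")
      case True
      have "fds_prod r (fds_euler_factor r t g) T n = \<Delta> n"
        if "finite T" "S n \<subseteq> T" "T \<subseteq> {p. prime p}" for T
        using that nS[OF True] smoothD by (intro \<Delta>_eq) (auto simp: smooth_def)
      then show ?thesis
        unfolding eventually_finite_subsets_at_top
        using fin[OF True] by (intro exI[of _ "S n"]) (auto simp: prime)
    next
      case False
      then show ?thesis
        by (intro eventually_finite_subsets_at_top_weakI) (simp add: fds_prod_outside \<Delta>_def)
    qed
  qed
  have one: "f i 1 = 1" if "i \<in> {1..r}" for i
    using mult[OF that] by (simp add: multiplicative_def)
  show "fds_coprime r f = fds_mult r (fds_prod r (\<lambda>i. fds_D r i (f i)) {1..r}) \<Delta>"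
  proof -
    have "fds_coprime r f = fds_mult r (fds_all r f) \<Delta>"
    proof
      fix n
      show "fds_coprime r f n = fds_mult r (fds_all r f) \<Delta> n"
      proof (cases "n \<in> tuples r")
        case n: True
        \<comment> \<open>All divisors and quotients of \<open>n\<close> are
          \<open>S n\<close>-smooth. Hence truncation to \<open>S n\<close> is invisible at
          \<open>n\<close>, and the finite Euler product can be replaced by \<Delta> in every
          term.\<close>
        have "fds_coprime r f n = fds_smooth r (S n) (fds_coprime r f) n"
          using nS[OF n] by (simp add: fds_smooth_def)
        also have "\<dots> = fds_mult r (fds_smooth r (S n) (fds_all r f))
            (fds_prod r (fds_euler_factor r t g) (S n)) n"
          using mult inverse fin[OF n] prime by (subst fds_coprime_smooth[where g = g and t = t]) auto
        also have "\<dots> = fds_mult r (fds_all r f) \<Delta> n"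
          unfolding fds_mult_eq[OF n]
        proof (intro sum.cong refl)
          fix d assume d: "d \<in> tdivisors r n"
          have "fds_prod r (fds_euler_factor r t g) (S n) (tdiv r n d) = \<Delta> (tdiv r n d)"
            using fin[OF n] prime smooth_tdivisors[OF nS[OF n] tdiv_tdivisors[OF d]] by (intro \<Delta>_eq)
          then show "fds_smooth r (S n) (fds_all r f) d *
              fds_prod r (fds_euler_factor r t g) (S n) (tdiv r n d) = fds_all r f d * \<Delta> (tdiv r n d)"
            using smooth_tdivisors[OF nS[OF n] d] by (simp add: fds_smooth_def)
        qed
        finally show ?thesis .
      qed (simp add: fds_mult_outside fds_coprime_def coprime_tuples_def)
    qed
    moreover have "fds_prod r (\<lambda>i. fds_D r i (f i)) {1..r} = fds_all r f"
      using one by (rule fds_prod_D)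
    ultimately show ?thesis by (simp only:)
  qed
qed

section \<open>Evaluation of formal Dirichlet series\<close>

definition fds_weight :: "nat \<Rightarrow> (nat \<Rightarrow> complex) \<Rightarrow> (nat \<Rightarrow> nat) \<Rightarrow> complex" where
  "fds_weight r s n = 1 / (\<Prod>i\<in>{1..r}. of_nat (n i) powr s i)"

text \<open>For complex terms, \<open>has_sum\<close> means absolute convergence with the given
  value, so reindexing and passing to subsets of tuples are unrestricted.\<close>

definition fds_has_value :: "nat \<Rightarrow> (nat \<Rightarrow> complex) \<Rightarrow> fds \<Rightarrow> complex \<Rightarrow> bool" where
  "fds_has_value r s F c \<longleftrightarrow> ((\<lambda>n. F n * fds_weight r s n) has_sum c) (tuples r)"

text \<open>The bases are nonnegative reals, so no branch of the logarithm interferes with a complex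
  exponent.\<close>

lemma powr_of_nat_mult: "(of_nat (a * b) :: complex) powr s = of_nat a powr s * of_nat b powr s"
  by (simp add: powr_times_real_left)

lemma powr_of_nat_power:
  assumes "p > 0"
  shows "(of_nat (p ^ a) :: complex) powr s = of_nat p powr (of_nat a * s)"
proof (induction a)
  case 0
  then show ?case using assms by simp
next
  case (Suc a)
  have "(of_nat (p ^ Suc a) :: complex) powr s = of_nat p powr s * of_nat (p ^ a) powr s"
    unfolding power_Suc by (rule powr_of_nat_mult)
  also have "\<dots> = of_nat p powr (of_nat (Suc a) * s)"
    unfolding Suc powr_add[symmetric] by (simp add: algebra_simps)
  finally show ?case .
qed

lemma fds_weight_tmult: "fds_weight r s (tmult r m k) = fds_weight r s m * fds_weight r s k"
proof -
  have "(\<Prod>i\<in>{1..r}. (of_nat (tmult r m k i) :: complex) powr s i) =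
      (\<Prod>i\<in>{1..r}. of_nat (m i) powr s i * of_nat (k i) powr s i)"
    by (intro prod.cong refl) (simp add: tmult_def powr_of_nat_mult del: of_nat_mult)
  then show ?thesis by (simp add: fds_weight_def prod.distrib)
qed

text \<open>Unordered summability of complex families is absolute. The family of products is
  therefore absolutely summable, and its sum may be computed iteratively.\<close>

lemma has_sum_times_complex:
  fixes f :: "'a \<Rightarrow> complex" and g :: "'b \<Rightarrow> complex"
  assumes f: "(f has_sum a) A" and g: "(g has_sum b) B"
  shows "((\<lambda>(x, y). f x * g y) has_sum (a * b)) (A \<times> B)"
proof (rule has_sum_SigmaI)
  fix x
  show "((\<lambda>y. case (x, y) of (x, y) \<Rightarrow> f x * g y) has_sum f x * b) B"
    using g by (simp add: has_sum_cmult_right)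
next
  show "((\<lambda>x. f x * b) has_sum a * b) A"
    using f by (rule has_sum_cmult_left)
next
  have f': "(\<lambda>x. norm (f x)) summable_on A" and g': "(\<lambda>y. norm (g y)) summable_on B"
    using f g has_sum_imp_summable summable_on_iff_abs_summable_on_complex by blast+
  have "(\<lambda>z. norm (case z of (x, y) \<Rightarrow> f x * g y)) summable_on (A \<times> B)"
    unfolding Infinite_Sum.abs_summable_on_Sigma_iff
  proof (intro conjI ballI)
    fix x
    show "(\<lambda>y. norm (case (x, y) of (x, y) \<Rightarrow> f x * g y)) summable_on B"
      using g' by (simp add: norm_mult summable_on_cmult_right)
  next
    have "(\<lambda>x. norm (f x) * norm (\<Sum>\<^sub>\<infinity>y\<in>B. norm (g y))) summable_on A"
      using f' by (rule summable_on_cmult_left)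
    then show "(\<lambda>x. norm (\<Sum>\<^sub>\<infinity>y\<in>B. norm (case (x, y) of (x, y) \<Rightarrow> f x * g y))) summable_on A"
      by (simp add: norm_mult infsum_cmult_right' abs_mult)
  qed
  then show "(\<lambda>(x, y). f x * g y) summable_on A \<times> B"
    by (rule abs_summable_summable)
qed

text \<open>The pairs \<open>(d, k)\<close> of tuples are regrouped according to their product
  \<open>n\<close>; the finite inner sum over the divisors of \<open>n\<close> is the coefficient of
  the convolution.\<close>

lemma fds_has_value_mult:
  assumes "fds_has_value r s F a" "fds_has_value r s H b"
  shows "fds_has_value r s (fds_mult r F H) (a * b)"
proof -
  define u where "u = (\<lambda>(n, d). F d * fds_weight r s d * (H (tdiv r n d) * fds_weight r s (tdiv r n d)))"
  have "((\<lambda>(d, k). F d * fds_weight r s d * (H k * fds_weight r s k)) has_sum (a * b)) (tuples r \<times> tuples r)"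
    using assms unfolding fds_has_value_def by (rule has_sum_times_complex)
  also have "?this \<longleftrightarrow> (u has_sum (a * b)) (SIGMA n:tuples r. tdivisors r n)"
    by (intro has_sum_reindex_bij_witness[where i = "\<lambda>(n, d). (d, tdiv r n d)" and j = "\<lambda>(d, k). (tmult r d k, d)"])
      (auto simp: u_def tdiv_tmult tmult_tdiv tmult_tuples tmult_tdivisors tdiv_tuples tdivisors_tuples)
  finally have sum: "(u has_sum (a * b)) (SIGMA n:tuples r. tdivisors r n)" .
  have "((\<lambda>n. fds_mult r F H n * fds_weight r s n) has_sum (a * b)) (tuples r)"
  proof (rule has_sum_SigmaD[OF sum])
    fix n assume n: "n \<in> tuples r"
    have "fds_mult r F H n * fds_weight r s n = (\<Sum>d\<in>tdivisors r n. u (n, d))"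
      unfolding fds_mult_eq[OF n] sum_distrib_right
    proof (intro sum.cong refl)
      fix d assume "d \<in> tdivisors r n"
      then have "fds_weight r s n = fds_weight r s d * fds_weight r s (tdiv r n d)"
        using tmult_tdiv[OF n, of d] by (simp flip: fds_weight_tmult)
      then show "F d * H (tdiv r n d) * fds_weight r s n = u (n, d)" by (simp add: u_def)
    qed
    then show "((\<lambda>d. u (n, d)) has_sum fds_mult r F H n * fds_weight r s n) (tdivisors r n)"
      using finite_tdivisors[OF n] by (simp add: has_sum_finite_iff)
  qed
  then show ?thesis by (simp add: fds_has_value_def)
qed

lemma fds_has_value_monom:
  assumes "\<And>i. i \<in> {1..r} \<Longrightarrow> m i > 0"
  shows "fds_has_value r s (fds_monom r m) (fds_weight r s m)"
proof -
  have "restrict m {1..r} \<in> tuples r" using assms by (intro tuplesI) auto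
  moreover have "fds_weight r s (restrict m {1..r}) = fds_weight r s m"
    by (simp add: fds_weight_def)
  ultimately show ?thesis
    unfolding fds_has_value_def
    by (intro has_sum_finite_neutralI[of "{restrict m {1..r}}"]) (auto simp: fds_monom_def)
qed

lemma fds_has_value_one: "fds_has_value r s (fds_one r) 1"
  using fds_has_value_monom[of r "\<lambda>_. 1" s] by (simp add: fds_one_def fds_weight_def)

lemma fds_has_value_prod:
  assumes "finite A" "\<And>k. k \<in> A \<Longrightarrow> fds_has_value r s (F k) (c k)"
  shows "fds_has_value r s (fds_prod r F A) (\<Prod>k\<in>A. c k)"
  using assms
  by (induction rule: finite_induct)
    (simp_all add: fds_prod_empty fds_prod_insert fds_has_value_one fds_has_value_mult)

lemma fds_has_value_diff:
  assumes "fds_has_value r s F a" "fds_has_value r s H b"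
  shows "fds_has_value r s (\<lambda>n. F n - H n) (a - b)"
  using has_sum_add[OF assms(1)[unfolded fds_has_value_def]
      has_sum_uminusI[OF assms(2)[unfolded fds_has_value_def]]]
  by (simp add: fds_has_value_def algebra_simps)

text \<open>For infinite \<open>A\<close> both sums take the default value 0, and the zero series
  has the value 0.\<close>

lemma fds_has_value_sum:
  assumes "\<And>k. k \<in> A \<Longrightarrow> fds_has_value r s (F k) (c k)"
  shows "fds_has_value r s (\<lambda>n. \<Sum>k\<in>A. F k n) (\<Sum>k\<in>A. c k)"
  using assms
proof (induction A rule: infinite_finite_induct)
  case (insert k A)
  then show ?case
    using has_sum_add[of "\<lambda>n. F k n * fds_weight r s n" "tuples r" "c k"]
    by (simp add: fds_has_value_def distrib_right)
qed (simp_all add: fds_has_value_def)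

lemma fds_has_value_cmult:
  assumes "fds_has_value r s F a"
  shows "fds_has_value r s (\<lambda>n. c * F n) (c * a)"
  using has_sum_cmult_right[OF assms[unfolded fds_has_value_def], of c]
  by (simp add: fds_has_value_def mult.assoc)

lemma fds_weight_prime_power:
  assumes "p > 0" "L \<subseteq> {1..r}"
  shows "fds_weight r s (\<lambda>l. if l \<in> L then p ^ a l else 1) =
    1 / of_nat p powr (\<Sum>l\<in>L. of_nat (a l) * s l)"
proof -
  have fin: "finite L" using assms(2) by (rule finite_subset) simp
  have "(\<Prod>i\<in>{1..r}. (of_nat (if i \<in> L then p ^ a i else 1) :: complex) powr s i) =
      (\<Prod>i\<in>L. of_nat p powr (of_nat (a i) * s i))"
    using assms by (intro prod.mono_neutral_cong_right) (auto simp: powr_of_nat_power simp del: of_nat_power)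
  also have "\<dots> = of_nat p powr (\<Sum>l\<in>L. of_nat (a l) * s l)"
    using fin assms(1) by (induction rule: finite_induct) (simp_all add: powr_add)
  finally show ?thesis by (simp add: fds_weight_def)
qed

text \<open>The formal factor is a finite combination of monomials, so it can be evaluated at every
  \<open>s\<close>. The two factors of each term are exchanged to bring the constant in front, as
  \<open>fds_has_value_cmult\<close> expects.\<close>

lemma fds_has_value_euler_factor:
  assumes p: "p > 0"
  shows "fds_has_value r s (fds_euler_factor r t g p) (euler_factor r t g s p)"
proof -
  have "fds_has_value r s (\<lambda>n. fds_one r n - (\<Sum>i=2..r. (of_nat i - 1) *
        (\<Sum>L | L \<subseteq> {1..r} \<and> card L = i. \<Sum>a\<in>L \<rightarrow>\<^sub>E {1..t}.
           (\<Prod>l\<in>L. (- 1) ^ a l * G g t l (a l) p) * fds_monom r (\<lambda>l. if l \<in> L then p ^ a l else 1) n)))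
     (1 - (\<Sum>i=2..r. (of_nat i - 1) *
        (\<Sum>L | L \<subseteq> {1..r} \<and> card L = i. \<Sum>a\<in>L \<rightarrow>\<^sub>E {1..t}.
           (\<Prod>l\<in>L. (- 1) ^ a l * G g t l (a l) p) * (1 / of_nat p powr (\<Sum>l\<in>L. of_nat (a l) * s l)))))"
  proof (intro fds_has_value_diff fds_has_value_sum fds_has_value_cmult fds_has_value_one)
    fix i L a assume "L \<in> {L. L \<subseteq> {1..r} \<and> card L = i}"
    then have L: "L \<subseteq> {1..r}" by simp
    show "fds_has_value r s (fds_monom r (\<lambda>l. if l \<in> L then p ^ a l else 1))
        (1 / of_nat p powr (\<Sum>l\<in>L. of_nat (a l) * s l))"
      using fds_has_value_monom[of r "\<lambda>l. if l \<in> L then p ^ a l else 1" s] p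
      unfolding fds_weight_prime_power[OF p L] by simp
  qed
  moreover have "fds_euler_factor r t g p = (\<lambda>n. fds_one r n - (\<Sum>i=2..r. (of_nat i - 1) *
        (\<Sum>L | L \<subseteq> {1..r} \<and> card L = i. \<Sum>a\<in>L \<rightarrow>\<^sub>E {1..t}.
           (\<Prod>l\<in>L. (- 1) ^ a l * G g t l (a l) p) * fds_monom r (\<lambda>l. if l \<in> L then p ^ a l else 1) n)))"
    unfolding fds_euler_factor_def[abs_def] by (simp only: mult.commute[of "fds_monom _ _ _"])
  moreover have "euler_factor r t g s p = 1 - (\<Sum>i=2..r. (of_nat i - 1) *
        (\<Sum>L | L \<subseteq> {1..r} \<and> card L = i. \<Sum>a\<in>L \<rightarrow>\<^sub>E {1..t}.
           (\<Prod>l\<in>L. (- 1) ^ a l * G g t l (a l) p) * (1 / of_nat p powr (\<Sum>l\<in>L. of_nat (a l) * s l))))"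
    unfolding euler_factor_def by (simp only: mult.commute[of "1 / _"])
  ultimately show ?thesis by (simp only:)
qed

lemma fds_has_value_D:
  assumes i: "i \<in> {1..r}" and conv: "dirichlet_abs_conv f (s i)"
  shows "fds_has_value r s (fds_D r i f) (dirichlet_series f (s i))"
proof -
  define h where "h = (\<lambda>n. f (Suc n) / of_nat (Suc n) powr s i)"
  \<comment> \<open>The numeric series is indexed from 0 with argument \<open>Suc n\<close>, so
    \<open>e n\<close> has the entry \<open>Suc n\<close> at position \<open>i\<close>; the inverse
    map subtracts 1.\<close>
  define e where "e = (\<lambda>n. \<lambda>j\<in>{1..r}. if j = i then Suc n else 1)"
  define T where "T = {n \<in> tuples r. \<forall>j\<in>{1..r}. j \<noteq> i \<longrightarrow> n j = 1}"
  have "(h has_sum dirichlet_series f (s i)) UNIV"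
    using conv unfolding dirichlet_abs_conv_def dirichlet_series_def h_def
    by (intro norm_summable_imp_has_sum summable_sums) (auto intro: summable_norm_cancel)
  also have "?this \<longleftrightarrow> ((\<lambda>n. fds_D r i f n * fds_weight r s n) has_sum dirichlet_series f (s i)) T"
  proof (rule has_sum_reindex_bij_witness[where i = "\<lambda>n. n i - 1" and j = e])
    fix n
    show "e n i - 1 = n" using i by (simp add: e_def)
    have en: "e n \<in> T"
      unfolding T_def by (intro CollectI conjI tuplesI) (auto simp: e_def)
    then show "e n \<in> T" .
    have "fds_D r i f (e n) = f (Suc n)"
      using en i unfolding T_def fds_D_def by (auto simp: e_def)
    moreover have "(\<Prod>j\<in>{1..r}. (of_nat (e n j) :: complex) powr s j) = of_nat (Suc n) powr s i"
      using i by (subst prod.remove[of _ i]) (auto simp: e_def intro!: prod.neutral)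
    ultimately show "fds_D r i f (e n) * fds_weight r s (e n) = h n"
      by (simp add: fds_weight_def h_def)
  next
    fix n assume n: "n \<in> T"
    then have "n i > 0" using i tuples_gt_0 by (auto simp: T_def)
    then show "e (n i - 1) = n"
      using n tuples_extensional by (intro extensionalityI[of _ "{1..r}"]) (auto simp: e_def T_def)
  qed auto
  also have "\<dots> \<longleftrightarrow> ((\<lambda>n. fds_D r i f n * fds_weight r s n) has_sum dirichlet_series f (s i)) (tuples r)"
    by (intro has_sum_cong_neutral) (auto simp: T_def fds_D_def)
  finally show ?thesis by (simp add: fds_has_value_def)
qed

section \<open>The analytic identity\<close>

text \<open>A finite set \<open>X\<close> approximates the full sum, and once \<open>A N\<close>
  contains \<open>X\<close>, a finite subset \<open>Z\<close> of \<open>A N\<close> approximates the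
  partial sum. The sum over \<open>X \<union> Z\<close> is then close to both limits.\<close>

lemma has_sum_exhaustion_tendsto:
  fixes h :: "'a \<Rightarrow> 'b :: {comm_monoid_add, metric_space}"
  assumes h: "(h has_sum c) T"
    and A: "\<And>N. A N \<subseteq> T" "\<And>x. x \<in> T \<Longrightarrow> eventually (\<lambda>N. x \<in> A N) F"
    and hA: "\<And>N. (h has_sum c' N) (A N)"
  shows "(c' \<longlongrightarrow> c) F"
proof (rule tendstoI)
  fix \<epsilon> :: real assume "\<epsilon> > 0"
  then have \<epsilon>: "\<epsilon> / 2 > 0" by simp
  have "\<forall>\<^sub>F X in finite_subsets_at_top T. dist (sum h X) c < \<epsilon> / 2"
    using h \<epsilon> unfolding has_sum_def by (rule tendstoD)
  then obtain X where X: "finite X" "X \<subseteq> T"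
    and close: "\<And>Y. finite Y \<Longrightarrow> X \<subseteq> Y \<Longrightarrow> Y \<subseteq> T \<Longrightarrow> dist (sum h Y) c < \<epsilon> / 2"
    unfolding eventually_finite_subsets_at_top by metis
  have "\<forall>\<^sub>F N in F. \<forall>x\<in>X. x \<in> A N"
    using X A(2) by (intro eventually_ball_finite) auto
  then show "\<forall>\<^sub>F N in F. dist (c' N) c < \<epsilon>"
  proof eventually_elim
    case (elim N)
    have "\<forall>\<^sub>F Y in finite_subsets_at_top (A N). dist (sum h Y) (c' N) < \<epsilon> / 2"
      using hA \<epsilon> unfolding has_sum_def by (rule tendstoD)
    then obtain Z where Z: "finite Z" "Z \<subseteq> A N"
      and close': "\<And>Y. finite Y \<Longrightarrow> Z \<subseteq> Y \<Longrightarrow> Y \<subseteq> A N \<Longrightarrow> dist (sum h Y) (c' N) < \<epsilon> / 2"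
      unfolding eventually_finite_subsets_at_top by metis
    have "dist (sum h (X \<union> Z)) c < \<epsilon> / 2" "dist (sum h (X \<union> Z)) (c' N) < \<epsilon> / 2"
      using close[of "X \<union> Z"] close'[of "X \<union> Z"] X Z elim A(1)[of N] by auto
    then show ?case by (metis dist_triangle_half_r)
  qed
qed

lemma fds_smooth_tendsto:
  assumes F: "fds_has_value r s F c"
  obtains c' where "\<And>N. fds_has_value r s (fds_smooth r {p. prime p \<and> p \<le> N} F) (c' N)"
    and "c' \<longlonglongrightarrow> c"
proof
  define h where "h = (\<lambda>n. F n * fds_weight r s n)"
  define A where "A = (\<lambda>N. smooth r {p. prime p \<and> p \<le> N})"
  have h: "(h has_sum c) (tuples r)" using F by (simp add: fds_has_value_def h_def)
  have AT: "A N \<subseteq> tuples r" for N using smooth_tuples by (auto simp: A_def)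
  have hA: "(h has_sum infsum h (A N)) (A N)" for N
    using h AT by (meson has_sum_imp_summable has_sum_infsum summable_on_subset_banach)
  then show "fds_has_value r s (fds_smooth r {p. prime p \<and> p \<le> N} F) (infsum h (A N))" for N
  proof -
    have "(h has_sum infsum h (A N)) (A N) \<longleftrightarrow>
        ((\<lambda>n. fds_smooth r {p. prime p \<and> p \<le> N} F n * fds_weight r s n) has_sum infsum h (A N)) (tuples r)"
      using AT[of N] by (intro has_sum_cong_neutral) (auto simp: fds_smooth_def A_def h_def)
    then show ?thesis using hA by (simp add: fds_has_value_def)
  qed
  show "(\<lambda>N. infsum h (A N)) \<longlonglongrightarrow> c"
  proof (rule has_sum_exhaustion_tendsto[OF h AT _ hA])
    fix n assume n: "n \<in> tuples r"
    \<comment> \<open>A prime dividing an entry is at most that entry, hence at most the sum of all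
      entries.\<close>
    have "n \<in> A N" if N: "(\<Sum>i\<in>{1..r}. n i) \<le> N" for N
      unfolding A_def
    proof (rule smoothI[OF n])
      fix i q assume i: "i \<in> {1..r}" and q: "prime q" "q dvd n i"
      have "q \<le> n i" using dvd_imp_le[OF q(2) tuples_gt_0[OF n i]] .
      also have "\<dots> \<le> (\<Sum>i\<in>{1..r}. n i)" using i by (intro member_le_sum) auto
      finally show "q \<in> {p. prime p \<and> p \<le> N}" using q N by simp
    qed
    then show "\<forall>\<^sub>F N in sequentially. n \<in> A N"
      using eventually_ge_at_top by (rule eventually_mono[rotated])
  qed
qed

lemma analytic_identity:
  assumes mult: "\<And>i. i \<in> {1..r} \<Longrightarrow> multiplicative (f i)"
    and inverse: "\<And>i p k. i \<in> {1..r} \<Longrightarrow> prime p \<Longrightarrow>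
      (\<Sum>a\<le>k. f i (p ^ a) * ((- 1) ^ (k - a) * G g t i (k - a) p)) = (if k = 0 then 1 else 0)"
    and summable: "multi_term r f s summable_on coprime_tuples r"
    and conv: "\<And>i. i \<in> {1..r} \<Longrightarrow> dirichlet_abs_conv (f i) (s i)"
    and euler: "convergent_prod (euler_factor_seq r t g s)"
  shows "(\<Sum>\<^sub>\<infinity>n\<in>coprime_tuples r. multi_term r f s n) =
    (\<Prod>i\<in>{1..r}. dirichlet_series (f i) (s i)) * Delta_bar r t g s"
proof -
  define S where "S = (\<lambda>N. {p::nat. prime p \<and> p \<le> N})"
  define E where "E = (\<lambda>N. \<Prod>p\<in>S N. euler_factor r t g s p)"
  have S: "finite (S N)" for N by (rule finite_subset[of _ "{..N}"]) (auto simp: S_def)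
  have "(multi_term r f s has_sum (\<Sum>\<^sub>\<infinity>n\<in>coprime_tuples r. multi_term r f s n)) (coprime_tuples r)"
    using summable by simp
  also have "?this \<longleftrightarrow> ((\<lambda>n. fds_coprime r f n * fds_weight r s n) has_sum
      (\<Sum>\<^sub>\<infinity>n\<in>coprime_tuples r. multi_term r f s n)) (tuples r)"
    by (intro has_sum_cong_neutral)
      (auto simp: fds_coprime_def multi_term_def fds_weight_def coprime_tuples_def)
  finally have "fds_has_value r s (fds_coprime r f) (\<Sum>\<^sub>\<infinity>n\<in>coprime_tuples r. multi_term r f s n)"
    by (simp add: fds_has_value_def)
  then obtain c where c: "\<And>N. fds_has_value r s (fds_smooth r (S N) (fds_coprime r f)) (c N)"
    and c_lim: "c \<longlonglongrightarrow> (\<Sum>\<^sub>\<infinity>n\<in>coprime_tuples r. multi_term r f s n)"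
    unfolding S_def by (rule fds_smooth_tendsto) blast
  have "fds_has_value r s (fds_prod r (\<lambda>i. fds_D r i (f i)) {1..r})
      (\<Prod>i\<in>{1..r}. dirichlet_series (f i) (s i))"
    using conv by (intro fds_has_value_prod fds_has_value_D) auto
  moreover have "fds_prod r (\<lambda>i. fds_D r i (f i)) {1..r} = fds_all r f"
    using mult by (intro fds_prod_D) (simp add: multiplicative_def)
  ultimately have "fds_has_value r s (fds_all r f) (\<Prod>i\<in>{1..r}. dirichlet_series (f i) (s i))"
    by (simp only:)
  then obtain d where d: "\<And>N. fds_has_value r s (fds_smooth r (S N) (fds_all r f)) (d N)"
    and d_lim: "d \<longlonglongrightarrow> (\<Prod>i\<in>{1..r}. dirichlet_series (f i) (s i))"
    unfolding S_def by (rule fds_smooth_tendsto) blast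
  \<comment> \<open>Both sides of the identity over the primes up to \<open>N\<close> are evaluated;
    uniqueness of sums turns it into an equation between numbers.\<close>
  have "c N = d N * E N" for N
  proof -
    have "fds_has_value r s (fds_prod r (fds_euler_factor r t g) (S N)) (E N)"
      unfolding E_def using S
      by (intro fds_has_value_prod fds_has_value_euler_factor) (auto simp: S_def prime_gt_0_nat)
    then have "fds_has_value r s (fds_mult r (fds_smooth r (S N) (fds_all r f))
        (fds_prod r (fds_euler_factor r t g) (S N))) (d N * E N)"
      using d by (intro fds_has_value_mult)
    also have "fds_mult r (fds_smooth r (S N) (fds_all r f)) (fds_prod r (fds_euler_factor r t g) (S N)) =
        fds_smooth r (S N) (fds_coprime r f)"
      using mult inverse S by (intro fds_coprime_smooth[symmetric]) (auto simp: S_def)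
    finally show ?thesis
      using c[of N] unfolding fds_has_value_def by (metis has_sum_unique)
  qed
  moreover have "E \<longlonglongrightarrow> Delta_bar r t g s"
  proof -
    \<comment> \<open>The factors 1 at nonprimes make the product over primes up to \<open>N\<close>
      a partial product of \<open>euler_factor_seq\<close>.\<close>
    have "E = (\<lambda>N. \<Prod>p\<le>N. euler_factor_seq r t g s p)"
    proof
      fix N
      have "(\<Prod>p\<le>N. euler_factor_seq r t g s p) = (\<Prod>p\<in>S N. euler_factor_seq r t g s p)"
        by (rule prod.mono_neutral_right) (auto simp: S_def euler_factor_seq_def)
      then show "E N = (\<Prod>p\<le>N. euler_factor_seq r t g s p)"
        by (simp add: E_def S_def euler_factor_seq_def)
    qed
    then show ?thesis
      unfolding Delta_bar_def using convergent_prod_LIMSEQ[OF euler] by (simp only:)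
  qed
  ultimately have "c \<longlonglongrightarrow> (\<Prod>i\<in>{1..r}. dirichlet_series (f i) (s i)) * Delta_bar r t g s"
    using tendsto_mult[OF d_lim] by presburger
  then show ?thesis using c_lim LIMSEQ_unique by blast
qed

theorem theorem6:
  fixes r t :: nat
    and f :: "nat \<Rightarrow> nat \<Rightarrow> complex"
    and g :: "nat \<Rightarrow> nat \<Rightarrow> nat \<Rightarrow> complex"
  assumes "r \<ge> 2" and "t \<ge> 1"
    and "\<And>i j. i \<in> {1..r} \<Longrightarrow> j \<in> {1..t} \<Longrightarrow> completely_mult (g i j)"
    and "\<And>i n. i \<in> {1..r} \<Longrightarrow> n \<ge> 1 \<Longrightarrow> f i n = dconv_upto (g i) t n"
  shows "(\<exists>\<Delta>. fds_has_prod r (fds_euler_factor r t g) {p. prime p} \<Delta> \<and>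
            fds_coprime r f = fds_mult r (fds_prod r (\<lambda>i. fds_D r i (f i)) {1..r}) \<Delta>)
       \<and> (\<forall>s :: nat \<Rightarrow> complex.
            (\<lambda>n. norm (multi_term r f s n)) summable_on coprime_tuples r \<longrightarrow>
            (\<forall>i\<in>{1..r}. dirichlet_abs_conv (f i) (s i)) \<longrightarrow>
            abs_convergent_prod (euler_factor_seq r t g s) \<longrightarrow>
            (\<Sum>\<^sub>\<infinity>n\<in>coprime_tuples r. multi_term r f s n) =
              (\<Prod>i\<in>{1..r}. dirichlet_series (f i) (s i)) * Delta_bar r t g s)"
proof -
  have mult: "multiplicative (f i)" if i: "i \<in> {1..r}" for i
  proof -
    have "multiplicative (dconv_upto (g i) t)"
      using assms(3)[OF i] by (rule multiplicative_dconv_upto)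
    \<comment> \<open>Since \<open>f i\<close> is tied to the convolution only at positive
      arguments, \<open>m * n\<close> must be seen to be positive.\<close>
    moreover have "f i (m * n) = dconv_upto (g i) t (m * n)" if "m \<ge> 1" "n \<ge> 1" for m n
      using assms(4)[OF i, of "m * n"] that by (simp add: Suc_le_eq One_nat_def)
    ultimately show ?thesis
      using assms(4)[OF i] unfolding multiplicative_def by simp
  qed
  have inverse: "(\<Sum>a\<le>k. f i (p ^ a) * ((- 1) ^ (k - a) * G g t i (k - a) p)) = (if k = 0 then 1 else 0)"
    if i: "i \<in> {1..r}" and p: "prime p" for i p k
  proof -
    have "f i (p ^ a) = dconv_upto (g i) t (p ^ a)" for a
      using prime_ge_1_nat[OF p] by (intro assms(4)[OF i]) simp
    then show ?thesis
      using dconv_upto_convolution_G[of t g i p k] assms(3)[OF i] p by simp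
  qed
  \<comment> \<open>Absolute summability of the terms and absolute convergence of the product yield
    the plain convergence that \<open>analytic_identity\<close> asks for.\<close>
  show ?thesis
    using formal_identity[OF mult inverse] analytic_identity[OF mult inverse]
      abs_summable_summable abs_convergent_prod_imp_convergent_prod by blast
qed

end
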